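(* Let $f$ be a transcendental meromorphic function in $\mathbb{C}$ such that $f^{-1}$ has a logarithmic singularity over $\infty$. Then the Hausdorff dimension of $J(f)$ is strictly greater than $1$.
   Context: $J(f)$ is the Julia set of $f$ (complement of the set where the iterates are defined and form a normal family). Logarithmic singularity over $\infty$: with $D_\chi(\infty,r)$ the spherical disc of radius $r$ about $\infty$, choose for each $r>0$ a component $U_r$ of $f^{-1}(D_\chi(\infty,r))$ with $U_{r_1}\subset U_{r_2}$ for $r_1<r_2$ and $\bigcap_r U_r=\emptyset$; it is logarithmic if for some $r>0$ the map $f:U_r\to D_\chi(\infty,r)\setminus\{\infty\}$ is a universal covering. *)

theory Defs
  imports "HOL-Complex_Analysis.Complex_Analysis" "HOL-Computational_Algebra.Polynomial"
begin

definition hausdorff_content :: "real \<Rightarrow> real \<Rightarrow> 'a::metric_space set \<Rightarrow> ennreal" where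
  "hausdorff_content s \<delta> A =
     (INF C \<in> {C :: nat \<Rightarrow> 'a set. A \<subseteq> (\<Union>n. C n) \<and> (\<forall>n. bounded (C n) \<and> diameter (C n) \<le> \<delta>)}.
        (\<Sum>n. ennreal (diameter (C n) powr s)))"

definition hausdorff_measure :: "real \<Rightarrow> 'a::metric_space set \<Rightarrow> ennreal" where
  "hausdorff_measure s A = (SUP \<delta> \<in> {0<..}. hausdorff_content s \<delta> A)"

definition hausdorff_dim :: "'a::metric_space set \<Rightarrow> real" where
  "hausdorff_dim A = Inf {s. 0 \<le> s \<and> hausdorff_measure s A = 0}"

text \<open>Stereographic projection of the plane onto the unit sphere in C x R; infinity is (0,1).\<close>
definition stereo :: "complex \<Rightarrow> complex \<times> real" where
  "stereo z = (complex_of_real (2 / (1 + (cmod z)^2)) * z, ((cmod z)^2 - 1) / ((cmod z)^2 + 1))"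

definition north_pole :: "complex \<times> real" where "north_pole = (0, 1)"

text \<open>One step of f on points of the plane, None meaning that the orbit has reached infinity
  (a pole); infinity is not in the domain of a transcendental f, so None is absorbing and
  the further iterates are undefined.\<close>
definition fstep :: "(complex \<Rightarrow> complex) \<Rightarrow> complex option \<Rightarrow> complex option" where
  "fstep f w = (case w of None \<Rightarrow> None | Some z \<Rightarrow> (if is_pole f z then None else Some (f z)))"

definition iter :: "(complex \<Rightarrow> complex) \<Rightarrow> nat \<Rightarrow> complex \<Rightarrow> complex" where
  "iter f n z = the ((fstep f ^^ n) (Some z))"

definition normal_family_chordal :: "complex set \<Rightarrow> (complex \<Rightarrow> complex) set \<Rightarrow> bool" where
  "normal_family_chordal U F \<longleftrightarrow>
     (\<forall>g :: nat \<Rightarrow> complex \<Rightarrow> complex. (\<forall>k. g k \<in> F) \<longrightarrow>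
        (\<exists>r h. strict_mono r \<and>
           (\<forall>K. compact K \<and> K \<subseteq> U \<longrightarrow>
               uniform_limit K (\<lambda>k z. stereo (g (r k) z)) h sequentially)))"

definition fatou_set :: "(complex \<Rightarrow> complex) \<Rightarrow> complex set" where
  "fatou_set f = {z. \<exists>U. open U \<and> z \<in> U \<and>
       (\<forall>n. \<forall>w\<in>U. (fstep f ^^ n) (Some w) \<noteq> None) \<and>
       normal_family_chordal U (range (iter f))}"

definition julia_set :: "(complex \<Rightarrow> complex) \<Rightarrow> complex set" where
  "julia_set f = - fatou_set f"

definition transcendental_meromorphic :: "(complex \<Rightarrow> complex) \<Rightarrow> bool" where
  "transcendental_meromorphic f \<longleftrightarrow> f nicely_meromorphic_on UNIV \<and>
     \<not> (\<exists>p q :: complex poly. q \<noteq> 0 \<and> (\<forall>z. poly q z \<noteq> 0 \<longrightarrow> f z = poly p z / poly q z))"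

text \<open>Preimage under f of the chordal disc of radius r about infinity (poles map to infinity).\<close>
definition preimage_disc_inf :: "(complex \<Rightarrow> complex) \<Rightarrow> real \<Rightarrow> complex set" where
  "preimage_disc_inf f r = {z. is_pole f z \<or> dist (stereo (f z)) north_pole < r}"

definition punct_disc_inf :: "real \<Rightarrow> complex set" where
  "punct_disc_inf r = {w. dist (stereo w) north_pole < r}"

definition log_singularity_over_inf :: "(complex \<Rightarrow> complex) \<Rightarrow> bool" where
  "log_singularity_over_inf f \<longleftrightarrow>
     (\<exists>U :: real \<Rightarrow> complex set.
        (\<forall>r>0. U r \<in> components (preimage_disc_inf f r)) \<and>
        (\<forall>r1 r2. 0 < r1 \<and> r1 < r2 \<longrightarrow> U r1 \<subseteq> U r2) \<and>
        (\<Inter>r\<in>{0<..}. U r) = {} \<and>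
        (\<exists>r>0. covering_space (U r) f (punct_disc_inf r) \<and> simply_connected (U r)))"

end

theory Submission
  imports Defs
begin

text \<open>In logarithmic coordinates a logarithmic tract is described by a holomorphic function \<open>G\<close> on a
  right half-plane with \<open>f (exp (G z)) = exp z\<close> and \<open>exp \<circ> G\<close> injective, and inverse branches of \<open>f\<close>
  become the maps \<open>z \<mapsto> G (z + 2 \<pi> i k)\<close> modulo \<open>2 \<pi> i\<close>. Bloch's theorem gives decay of the derivative of
  \<open>G\<close>, and Schottky's theorem bounds its distortion. On each vertical line the real part of \<open>G\<close> grows
  slowly in the abscissa but tends to infinity along the line, so for large \<open>L\<close> every point of the strip
  \<open>L \<le> Re z \<le> 2 L\<close> has finitely many preimages in the same strip along which the derivatives sum up to
  a large number. The sum still exceeds 2 with some exponent \<open>t > 1\<close>. Passing to a cycle in a finite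
  graph of small discs yields a finite conformal iterated function system on a single disc, whose
  branches are inverse branches of one iterate of \<open>f\<close>. Its limit set has dimension at least \<open>t\<close> and
  lies in the Julia set because the branches contract.\<close>

text \<open>The gain comes from a conflict between two facts. Bloch's theorem bounds
  \<open>(Re w - h0) * cmod (deriv G w)\<close>, so far to the right \<open>G\<close> is so flat
  that a point of the strip near the real axis has an image with real part at most \<open>L\<close>.
  Yet the images of its vertical translates run through the preimages of a single point in the
  tract, and these leave every compact set. The real part must therefore cross the whole interval
  from \<open>L\<close> to \<open>2 * L\<close> in steps controlled by the derivative, and the
  length of this interval is free to choose. Restricting to preimages in the same strip keeps all
  targets, modulo \<open>2 \<pi> i\<close>, in one compact rectangle; this is what makes the graph
  and the set of ratios finite. Strict inequality follows from this finiteness: the sum at exponent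
  1 exceeds 2 by a definite factor, and finitely many positive ratios allow a slightly larger
  exponent.\<close>

section \<open>Distortion of univalent functions\<close>

text \<open>If \<open>k\<close> is univalent with \<open>k 0 = 0\<close> and omits the value \<open>k q\<close>, then the square root of
  \<open>1 - k / k q\<close> with value 1 at 0 omits 0 and -1, so that Schottky's theorem bounds it.\<close>
lemma univalent_growth:
  fixes k :: "complex \<Rightarrow> complex"
  assumes hol: "k holomorphic_on ball 0 2" and inj: "inj_on k (ball 0 2)" and k0: "k 0 = 0"
    and w: "cmod w \<le> 1/2"
  shows "cmod (k w) \<le> 3/2 * (1 + (exp (pi * exp (pi * 16)))\<^sup>2) * cmod (deriv k 0)"
proof -
  have d0: "deriv k 0 \<noteq> 0"
    using holomorphic_injective_imp_regular[OF hol open_ball inj] by simp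
  have kn0: "k z \<noteq> 0" if "z \<in> ball 0 2" "z \<noteq> 0" for z
    using inj_onD[OF inj, of z 0] that k0 by auto
  \<comment> \<open>\<open>Q\<close> is \<open>k z / z\<close> with the removable singularity filled
    in. It has no zeros, so the maximum modulus principle applies to \<open>1 / Q\<close>; at 0 it
    bounds the minimum of \<open>cmod (k z)\<close> on the circle of radius 3/2 by
    \<open>3/2 * cmod (deriv k 0)\<close>.\<close>
  define Q where "Q = (\<lambda>z. if z = 0 then deriv k 0 else (k z - k 0) / (z - 0))"
  have Qhol: "Q holomorphic_on ball 0 2"
    unfolding Q_def by (rule pole_lemma[OF hol]) simp
  have Qn0: "Q z \<noteq> 0" if "z \<in> ball 0 2" for z
    using that kn0 d0 k0 by (auto simp: Q_def)
  have "\<exists>q\<in>sphere 0 (3/2). \<forall>z\<in>sphere 0 (3/2). cmod (k q) \<le> cmod (k z)"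
    by (rule continuous_attains_inf)
       (auto intro!: continuous_intros holomorphic_on_imp_continuous_on holomorphic_on_subset[OF hol])
  then obtain q where q: "cmod q = 3/2" and qmin: "\<And>z. cmod z = 3/2 \<Longrightarrow> cmod (k q) \<le> cmod (k z)"
    by auto
  have kq: "k q \<noteq> 0" using kn0[of q] q by force
  have "cmod (inverse (Q 0)) \<le> (3/2) / cmod (k q)"
  proof (rule maximum_modulus_frontier[of "\<lambda>z. inverse (Q z)" "cball 0 (3/2)"])
    show "(\<lambda>z. inverse (Q z)) holomorphic_on interior (cball 0 (3/2))"
      using Qn0 by (intro holomorphic_intros holomorphic_on_subset[OF Qhol]) auto
    show "continuous_on (closure (cball 0 (3/2))) (\<lambda>z. inverse (Q z))"
      using Qn0 by (intro holomorphic_on_imp_continuous_on holomorphic_intros holomorphic_on_subset[OF Qhol]) auto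
    show "cmod (inverse (Q z)) \<le> (3/2) / cmod (k q)" if "z \<in> frontier (cball 0 (3/2))" for z
    proof -
      have z: "cmod z = 3/2" using that by (simp add: frontier_cball)
      hence "z \<noteq> 0" by auto
      hence "cmod (inverse (Q z)) = (3/2) / cmod (k z)"
        using k0 by (simp add: Q_def norm_divide norm_inverse flip: z)
      also have "\<dots> \<le> (3/2) / cmod (k q)"
        using qmin[OF z] kq by (intro divide_left_mono mult_pos_pos) (auto intro: less_le_trans[of _ "cmod (k q)"])
      finally show ?thesis .
    qed
  qed auto
  hence kqle: "cmod (k q) \<le> 3/2 * cmod (deriv k 0)"
    using kq d0 by (simp add: Q_def norm_inverse norm_divide field_simps)
  define u where "u = (\<lambda>z. 1 - k z / k q)"
  have uhol: "u holomorphic_on ball 0 (3/2)"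
    unfolding u_def using kq by (intro holomorphic_intros holomorphic_on_subset[OF hol]) auto
  \<comment> \<open>The point \<open>q\<close> lies on the boundary circle, so injectivity keeps the
    value \<open>k q\<close> out of the image of the open disc.\<close>
  have un0: "u z \<noteq> 0" if "z \<in> ball 0 (3/2)" for z
  proof
    assume "u z = 0"
    hence "k z = k q" using kq by (simp add: u_def)
    hence "z = q" using inj_onD[OF inj, of z q] that q by auto
    thus False using that q by auto
  qed
  have "contractible (ball 0 (3/2) :: complex set)"
    by (rule convex_imp_contractible) simp
  then obtain h where hhol: "h holomorphic_on ball 0 (3/2)" and h: "\<And>z. z \<in> ball 0 (3/2) \<Longrightarrow> u z = (h z)\<^sup>2"
    using contractible_imp_holomorphic_sqrt[OF uhol _ un0] by auto
  have u0: "u 0 = 1" by (simp add: u_def k0)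
  have h0: "(h 0)\<^sup>2 = 1" using h[of 0] u0 by simp
  \<comment> \<open>Normalized to \<open>F 0 = -1\<close>, the root omits Schottky's values 0 and 1:
    \<open>F z = 1\<close> would give \<open>k z = 0\<close>, hence \<open>z = 0\<close>. With
    \<open>cmod (F 0) \<le> 1\<close> and radius 1/2, Schottky's inner constant is 4 + 12 =
    16.\<close>
  define F where "F = (\<lambda>z. - h z / h 0)"
  have h0n: "h 0 \<noteq> 0" using h0 by auto
  have Fsq: "(F z)\<^sup>2 = u z" if "z \<in> ball 0 (3/2)" for z
    using h[OF that] h0 by (simp add: F_def power_divide)
  have Fz: "cmod (F w) \<le> exp (pi * exp (pi * (2 + 2 * 1 + 12 * (1/2) / (1 - 1/2))))"
  proof (rule Schottky[of F])
    show "F holomorphic_on cball 0 1"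
      unfolding F_def using h0n by (intro holomorphic_intros holomorphic_on_subset[OF hhol]) auto
    show "cmod (F 0) \<le> 1" using h0n by (simp add: F_def)
    show "\<not> (F z = 0 \<or> F z = 1)" if z: "z \<in> cball 0 1" for z
    proof -
      have zb: "z \<in> ball 0 (3/2)" using z by auto
      have "F z \<noteq> 0" using Fsq[OF zb] un0[OF zb] by auto
      moreover have "F z \<noteq> 1"
      proof
        assume F1: "F z = 1"
        hence "u z = 1" using Fsq[OF zb] by simp
        hence "k z = 0" using kq by (simp add: u_def)
        hence "z = 0" using kn0[of z] z by auto
        thus False using F1 h0n by (simp add: F_def)
      qed
      ultimately show ?thesis by simp
    qed
  qed (use w in auto)
  have "cmod (u w) = (cmod (F w))\<^sup>2"
    using Fsq[of w] w by (simp flip: norm_power)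
  also have "\<dots> \<le> (exp (pi * exp (pi * 16)))\<^sup>2"
    using Fz by (intro power_mono) auto
  finally have uw: "cmod (u w) \<le> (exp (pi * exp (pi * 16)))\<^sup>2" .
  have "k w = (1 - u w) * k q" using kq by (simp add: u_def)
  hence "cmod (k w) = cmod (1 - u w) * cmod (k q)" by (simp add: norm_mult)
  also have "\<dots> \<le> (1 + (exp (pi * exp (pi * 16)))\<^sup>2) * (3/2 * cmod (deriv k 0))"
    using uw norm_triangle_ineq4[of 1 "u w"] kqle by (intro mult_mono) auto
  finally show ?thesis by (simp add: algebra_simps)
qed

text \<open>The growth bound controls \<open>g - g a\<close> on the disc of radius
  \<open>R/4\<close> by a multiple of \<open>R * cmod (deriv g a)\<close>. Cauchy's estimate turns
  this into a bound for the second derivative, so the derivative hardly varies on a disc much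
  smaller than \<open>R\<close>. The constant is the same for all \<open>g\<close>.\<close>

lemma univalent_near_linear:
  "\<exists>K>0. \<forall>(g::complex \<Rightarrow> complex) a R s. g holomorphic_on ball a R \<longrightarrow> inj_on g (ball a R) \<longrightarrow> 0 < s \<longrightarrow> K * s \<le> R \<longrightarrow>
     (\<forall>x\<in>cball a s. \<forall>y\<in>cball a s.
        cmod (g x - g y - deriv g a * (x - y)) \<le> cmod (deriv g a) * cmod (x - y) / 4)"
proof -
  define M where "M = 3/2 * (1 + (exp (pi * exp (pi * 16)))\<^sup>2)"
  have M: "M \<ge> 1" unfolding M_def by (simp add: add_increasing2)
  \<comment> \<open>This size gives \<open>s \<le> R/8\<close>, the disc where Cauchy's estimate is
    used, and makes the variation factor \<open>64 * M / R * s\<close> at most 1/4.\<close>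
  define K where "K = 1024 * M"
  show ?thesis
  proof (intro exI[of _ K] conjI allI impI ballI)
    show "K > 0" using M by (simp add: K_def)
    fix g :: "complex \<Rightarrow> complex" and a :: complex and R s :: real and x y
    assume hol: "g holomorphic_on ball a R" and inj: "inj_on g (ball a R)"
      and s: "0 < s" and KsR: "K * s \<le> R" and x: "x \<in> cball a s" and y: "y \<in> cball a s"
    have "1024 * s \<le> 1024 * M * s" using M s by simp
    hence sR: "1024 * s \<le> R" using KsR by (simp add: K_def)
    have R: "R > 0" using sR s by linarith
    define D where "D = cmod (deriv g a)"
    have bound: "cmod (g z - g a) \<le> M * (R/2) * D" if z: "z \<in> cball a (R/4)" for z
    proof -
      define k where "k = (\<lambda>w. g (a + of_real (R/2) * w) - g a)"
      have mem: "a + of_real (R/2) * w \<in> ball a R" if "w \<in> ball 0 2" for w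
        using that R by (simp add: dist_norm norm_mult)
      have gd: "(g has_field_derivative deriv g a) (at (a + of_real (R/2) * 0))"
        using holomorphic_derivI[OF hol open_ball, of a] R by simp
      have "(k has_field_derivative deriv g a * of_real (R/2)) (at 0)"
        unfolding k_def
        by (rule derivative_eq_intros DERIV_chain2[where f=g and g="\<lambda>w. a + of_real (R/2) * w", OF gd] refl | simp)+
      hence dk: "deriv k 0 = deriv g a * of_real (R/2)" by (rule DERIV_imp_deriv)
      have "cmod (k (2 / R * (z - a))) \<le> 3/2 * (1 + (exp (pi * exp (pi * 16)))\<^sup>2) * cmod (deriv k 0)"
      proof (rule univalent_growth)
        have "g \<circ> (\<lambda>w. a + of_real (R/2) * w) holomorphic_on ball 0 2"
          by (rule holomorphic_on_compose_gen[OF _ hol]) (use mem in \<open>auto intro!: holomorphic_intros\<close>)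
        thus "k holomorphic_on ball 0 2" unfolding k_def by (auto intro!: holomorphic_intros simp: o_def)
        show "inj_on k (ball 0 2)"
        proof (rule inj_onI)
          fix u v assume "u \<in> ball 0 2" "v \<in> ball 0 2" "k u = k v"
          hence "a + of_real (R/2) * u = a + of_real (R/2) * v"
            using inj_onD[OF inj _ mem mem] by (auto simp: k_def)
          thus "u = v" using R by simp
        qed
        show "k 0 = 0" by (simp add: k_def)
        show "cmod (2 / R * (z - a)) \<le> 1/2"
        proof -
          have "cmod (2 / R * (z - a)) = 2 / R * dist a z"
            unfolding norm_mult using R by (simp add: norm_divide dist_norm norm_minus_commute)
          also have "\<dots> \<le> 2 / R * (R/4)" using z R by (intro mult_left_mono) auto
          finally show ?thesis using R by simp
        qed
      qed
      moreover have "k (2 / R * (z - a)) = g z - g a"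
      proof -
        have "a + of_real (R/2) * (2 / R * (z - a)) = z" using R by (simp add: field_simps)
        thus ?thesis by (simp only: k_def)
      qed
      ultimately show ?thesis using R by (simp add: dk D_def M_def norm_mult norm_divide mult_ac)
    qed
    have dbound: "cmod (deriv (deriv g) z) \<le> 64 * M / R * D" if z: "z \<in> cball a (R/8)" for z
    proof -
      have sub: "cball z (R/8) \<subseteq> cball a (R/4)"
      proof
        fix w assume "w \<in> cball z (R/8)"
        thus "w \<in> cball a (R/4)" using z dist_triangle[of a w z] by auto
      qed
      have hs: "(\<lambda>w. g w - g a) holomorphic_on cball a (R/4)"
        using R by (intro holomorphic_intros holomorphic_on_subset[OF hol]) auto
      have sub': "cball z (R/8) \<subseteq> ball a R" using sub R by (auto dest!: subsetD)
      have "cmod ((deriv ^^ 2) (\<lambda>w. g w - g a) z) \<le> fact 2 * (M * (R/2) * D) / (R/8)^2"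
      proof (rule Cauchy_inequality)
        show "(\<lambda>w. g w - g a) holomorphic_on ball z (R/8)"
          using sub' by (intro holomorphic_intros holomorphic_on_subset[OF hol]) auto
        show "continuous_on (cball z (R/8)) (\<lambda>w. g w - g a)"
          by (rule holomorphic_on_imp_continuous_on, rule holomorphic_on_subset[OF hs sub])
        show "0 < R/8" using R by simp
        show "cmod (g w - g a) \<le> M * (R/2) * D" if "cmod (z - w) = R/8" for w
          by (rule bound, rule subsetD[OF sub]) (use that in \<open>auto simp: dist_norm\<close>)
      qed
      moreover have "(deriv ^^ 2) (\<lambda>w. g w - g a) z = deriv (deriv g) z"
      proof -
        have "(deriv ^^ 2) (\<lambda>w. g w - g a) z = (deriv ^^ 2) g z - (deriv ^^ 2) (\<lambda>w. g a) z"
          by (rule higher_deriv_diff[OF hol _ open_ball]) (use z R in auto)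
        thus ?thesis by (simp add: numeral_2_eq_2)
      qed
      ultimately show ?thesis using R by (simp add: power2_eq_square field_simps)
    qed
    have dg: "deriv g holomorphic_on ball a R" by (rule holomorphic_deriv[OF hol open_ball])
    have near: "cmod (deriv g z - deriv g a) \<le> D / 4" if z: "z \<in> cball a s" for z
    proof -
      have "cmod (deriv g z - deriv g a) \<le> (64 * M / R * D) * cmod (z - a)"
      proof (rule field_differentiable_bound[OF convex_cball[of a "R/8"]])
        show "(deriv g has_field_derivative deriv (deriv g) w) (at w within cball a (R/8))"
          if "w \<in> cball a (R/8)" for w
          by (rule has_field_derivative_at_within, rule holomorphic_derivI[OF dg open_ball])
             (use that R in auto)
      qed (use dbound z sR R s in auto)
      also have "\<dots> \<le> (64 * M / R * D) * s"
        using z M R by (intro mult_left_mono) (auto simp: dist_norm norm_minus_commute D_def)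
      also have "\<dots> \<le> D / 4"
      proof -
        have "0 \<le> M * s" using M s by simp
        hence "64 * M * s \<le> R / 4" using KsR by (simp add: K_def)
        hence "64 * M * s / R \<le> 1/4" using R by (simp add: field_simps)
        hence "64 * M * s / R * D \<le> 1/4 * D" by (rule mult_right_mono) (simp add: D_def)
        moreover have "64 * M * s / R * D = (64 * M / R * D) * s" by simp
        ultimately show ?thesis by linarith
      qed
      finally show ?thesis .
    qed
    have "cmod ((g x - deriv g a * x) - (g y - deriv g a * y)) \<le> (D / 4) * cmod (x - y)"
    proof (rule field_differentiable_bound[OF convex_cball[of a s]])
      show "((\<lambda>z. g z - deriv g a * z) has_field_derivative deriv g w - deriv g a) (at w within cball a s)"
        if "w \<in> cball a s" for w
      proof -
        have "(g has_field_derivative deriv g w) (at w)"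
          by (rule holomorphic_derivI[OF hol open_ball]) (use that R sR s in auto)
        from DERIV_diff[OF this DERIV_cmult_Id[of "deriv g a"]] show ?thesis
          by (rule has_field_derivative_at_within)
      qed
    qed (use near x y in auto)
    thus "cmod (g x - g y - deriv g a * (x - y)) \<le> cmod (deriv g a) * cmod (x - y) / 4"
      by (simp add: D_def algebra_simps)
  qed
qed

text \<open>By Bloch's theorem the image contains a disc of radius
  \<open>R * cmod (deriv G a) / 12\<close>. If this exceeds 4, hence \<pi>, the disc contains two
  points that differ by \<open>2 \<pi> i\<close>, against injectivity of
  \<open>exp \<circ> G\<close>; 48 is 12 times 4.\<close>

lemma exp_inj_deriv_bound:
  assumes hol: "G holomorphic_on ball a R" and R: "R > 0"
    and inj: "\<And>x y. x \<in> ball a R \<Longrightarrow> y \<in> ball a R \<Longrightarrow> exp (G x) = exp (G y) \<Longrightarrow> x = y"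
  shows "R * cmod (deriv G a) \<le> 48"
proof (rule ccontr)
  assume "\<not> ?thesis"
  hence big: "48 < R * cmod (deriv G a)" by simp
  obtain b where b: "ball b (R * cmod (deriv G a) / 12) \<subseteq> G ` ball a R"
    using Bloch[OF hol R, of "R * cmod (deriv G a) / 12"] by auto
  have "pi < 4" by (rule pi_less_4)
  hence "b + \<i> * pi \<in> G ` ball a R" "b - \<i> * pi \<in> G ` ball a R"
    using big by (auto intro!: subsetD[OF b] simp: dist_norm norm_mult)
  then obtain x y where xy: "x \<in> ball a R" "G x = b + \<i> * pi" "y \<in> ball a R" "G y = b - \<i> * pi"
    by (metis imageE)
  have "exp (G x) = exp (G y)" by (simp add: xy exp_add exp_diff cis_conv_exp[symmetric])
  hence "x = y" using inj xy by blast
  thus False using xy by simp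
qed

section \<open>Lower bounds for the Hausdorff dimension\<close>

lemma diameter_leI:
  fixes S :: "'a::metric_space set"
  assumes "0 \<le> d" "\<And>x y. x \<in> S \<Longrightarrow> y \<in> S \<Longrightarrow> dist x y \<le> d"
  shows "bounded S \<and> diameter S \<le> d"
proof -
  have "bounded S" using assms(2) unfolding bounded_two_points by blast
  moreover have "diameter S \<le> d"
    using assms by (auto simp: diameter_def intro!: cSUP_least)
  ultimately show ?thesis ..
qed

text \<open>Induction on the number of covering sets: sets of diameter below the separation \<open>\<delta>\<close> meet only
  one of the pieces \<open>h \<phi> ` X\<close>, and the part of the cover that meets a piece pulls back to a smaller
  cover of \<open>X\<close>.\<close>
lemma finite_cover_sum_ge:
  fixes X :: "'a::metric_space set" and \<Phi> :: "'p set" and h :: "'p \<Rightarrow> 'a \<Rightarrow> 'a" and b :: "'p \<Rightarrow> real" and C :: "'i \<Rightarrow> 'a set"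
  assumes \<Phi>: "finite \<Phi>" "card \<Phi> \<ge> 2" and X: "X \<noteq> {}"
    and h: "\<And>\<phi>. \<phi> \<in> \<Phi> \<Longrightarrow> 0 < b \<phi> \<and> h \<phi> ` X \<subseteq> X \<and> (\<forall>x\<in>X. \<forall>y\<in>X. b \<phi> * dist x y \<le> dist (h \<phi> x) (h \<phi> y))"
    and sep: "\<And>\<phi> \<psi> x y. \<phi> \<in> \<Phi> \<Longrightarrow> \<psi> \<in> \<Phi> \<Longrightarrow> \<phi> \<noteq> \<psi> \<Longrightarrow> x \<in> X \<Longrightarrow> y \<in> X \<Longrightarrow> \<delta> \<le> dist (h \<phi> x) (h \<psi> y)"
    and \<delta>: "\<delta> > 0" and t: "t > 0" and weight: "(\<Sum>\<phi>\<in>\<Phi>. b \<phi> powr t) \<ge> 1"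
    and I: "finite I" "X \<subseteq> (\<Union>i\<in>I. C i)" "\<And>i. i \<in> I \<Longrightarrow> bounded (C i)"
  shows "\<delta> powr t \<le> (\<Sum>i\<in>I. diameter (C i) powr t)"
  using I
proof (induction "card I" arbitrary: I C rule: less_induct)
  case less
  show ?case
  proof (cases "\<exists>i\<in>I. \<delta> \<le> diameter (C i)")
    case True
    then obtain i where i: "i \<in> I" "\<delta> \<le> diameter (C i)" by blast
    have "\<delta> powr t \<le> diameter (C i) powr t" using i \<delta> t by (intro powr_mono2) auto
    also have "\<dots> \<le> (\<Sum>i\<in>I. diameter (C i) powr t)"
      using i less.prems(1) by (intro member_le_sum) auto
    finally show ?thesis .
  next
    case False
    hence small: "diameter (C i) < \<delta>" if "i \<in> I" for i using that by force
    define J where "J = (\<lambda>\<phi>. {i \<in> I. C i \<inter> h \<phi> ` X \<noteq> {}})"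
    have Jsub: "J \<phi> \<subseteq> I" for \<phi> by (auto simp: J_def)
    have Jfin: "finite (J \<phi>)" for \<phi> using finite_subset[OF Jsub less.prems(1)] .
    have Jne: "J \<phi> \<noteq> {}" if "\<phi> \<in> \<Phi>" for \<phi>
    proof -
      obtain x where x: "x \<in> X" using X by blast
      hence "h \<phi> x \<in> X" using h[OF that] by auto
      then obtain i where "i \<in> I" "h \<phi> x \<in> C i" using less.prems(2) by blast
      thus ?thesis using x by (auto simp: J_def)
    qed
    have Jdisj: "J \<phi> \<inter> J \<psi> = {}" if "\<phi> \<in> \<Phi>" "\<psi> \<in> \<Phi>" "\<phi> \<noteq> \<psi>" for \<phi> \<psi>
    proof (rule ccontr)
      assume "J \<phi> \<inter> J \<psi> \<noteq> {}"
      then obtain i x y where i: "i \<in> I" and x: "x \<in> X" "h \<phi> x \<in> C i" and y: "y \<in> X" "h \<psi> y \<in> C i"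
        by (auto simp: J_def)
      have "dist (h \<phi> x) (h \<psi> y) \<le> diameter (C i)"
        using less.prems(3)[OF i] x y by (intro diameter_bounded_bound)
      moreover have "\<delta> \<le> dist (h \<phi> x) (h \<psi> y)"
        using that x y sep[of \<phi> \<psi> x y] by auto
      ultimately show False using small[OF i] by linarith
    qed
    have piece: "b \<phi> powr t * \<delta> powr t \<le> (\<Sum>i\<in>J \<phi>. diameter (C i) powr t)" if hb: "\<phi> \<in> \<Phi>" for \<phi>
    proof -
      note hh = h[OF hb]
      \<comment> \<open>A second branch occupies at least one covering set, and that set does not
        meet the piece of \<open>\<phi>\<close>; so the index set strictly shrinks.\<close>
      have "\<Phi> \<noteq> {\<phi>}" using \<Phi>(2) by auto
      then obtain \<psi> where \<psi>: "\<psi> \<in> \<Phi>" "\<psi> \<noteq> \<phi>" using hb by blast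
      have "J \<phi> \<subset> I" using Jdisj[OF \<psi>(1) hb \<psi>(2)] Jne[OF \<psi>(1)] Jsub[of \<psi>] Jsub[of \<phi>] by blast
      hence card: "card (J \<phi>) < card I" by (rule psubset_card_mono[OF less.prems(1)])
      define D where "D = (\<lambda>i. {x \<in> X. h \<phi> x \<in> C i})"
      have D: "bounded (D i) \<and> diameter (D i) \<le> diameter (C i) / b \<phi>" if i: "i \<in> I" for i
      proof (rule diameter_leI)
        show "0 \<le> diameter (C i) / b \<phi>" using hh diameter_ge_0[OF less.prems(3)[OF i]] by simp
        fix x y assume xy: "x \<in> D i" "y \<in> D i"
        hence "b \<phi> * dist x y \<le> dist (h \<phi> x) (h \<phi> y)" using hh by (auto simp: D_def)
        also have "\<dots> \<le> diameter (C i)"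
          using xy less.prems(3)[OF i] by (intro diameter_bounded_bound) (auto simp: D_def)
        finally show "dist x y \<le> diameter (C i) / b \<phi>" using hh by (simp add: field_simps)
      qed
      have "\<delta> powr t \<le> (\<Sum>i\<in>J \<phi>. diameter (D i) powr t)"
      proof (rule less.hyps[OF card Jfin])
        show "X \<subseteq> (\<Union>i\<in>J \<phi>. D i)"
        proof
          fix x assume x: "x \<in> X"
          hence "h \<phi> x \<in> X" using hh by auto
          then obtain i where "i \<in> I" "h \<phi> x \<in> C i" using less.prems(2) by blast
          thus "x \<in> (\<Union>i\<in>J \<phi>. D i)" using x by (auto simp: J_def D_def)
        qed
        show "bounded (D i)" if "i \<in> J \<phi>" for i using D that Jsub by blast
      qed
      also have "\<dots> \<le> (\<Sum>i\<in>J \<phi>. (diameter (C i) / b \<phi>) powr t)"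
        using D Jsub t by (intro sum_mono powr_mono2) (auto intro!: diameter_ge_0)
      also have "\<dots> = (\<Sum>i\<in>J \<phi>. diameter (C i) powr t / b \<phi> powr t)"
        using hh Jsub less.prems(3) by (intro sum.cong refl powr_divide)
      finally show ?thesis using hh by (simp add: sum_divide_distrib[symmetric] field_simps)
    qed
    have "1 * \<delta> powr t \<le> (\<Sum>\<phi>\<in>\<Phi>. b \<phi> powr t) * \<delta> powr t" using weight by (intro mult_right_mono) auto
    also have "\<dots> = (\<Sum>\<phi>\<in>\<Phi>. b \<phi> powr t * \<delta> powr t)" by (simp add: sum_distrib_right)
    also have "\<dots> \<le> (\<Sum>\<phi>\<in>\<Phi>. \<Sum>i\<in>J \<phi>. diameter (C i) powr t)"
      using piece by (intro sum_mono) auto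
    also have "\<dots> = (\<Sum>i\<in>(\<Union>\<phi>\<in>\<Phi>. J \<phi>). diameter (C i) powr t)"
      using \<Phi> Jfin Jdisj by (intro sum.UNION_disjoint[symmetric]) auto
    also have "\<dots> \<le> (\<Sum>i\<in>I. diameter (C i) powr t)"
      using Jsub less.prems(1) by (intro sum_mono2) auto
    finally show ?thesis by simp
  qed
qed

text \<open>Each set is thickened to an open one so slightly that the powers of the diameters grow
  by at most \<open>e\<close> in total; compactness then leaves a finite cover. Continuity of the
  power at 0, which needs \<open>t > 0\<close>, handles sets of diameter 0.\<close>

lemma countable_cover_sum_ge:
  fixes X :: "'a::metric_space set" and C :: "nat \<Rightarrow> 'a set"
  assumes X: "compact X" and t: "t > 0"
    and fin: "\<And>(N :: nat set) D :: nat \<Rightarrow> 'a set. finite N \<Longrightarrow> X \<subseteq> (\<Union>n\<in>N. D n) \<Longrightarrow> (\<And>n. n \<in> N \<Longrightarrow> bounded (D n)) \<Longrightarrow>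
               c \<le> (\<Sum>n\<in>N. diameter (D n) powr t)"
    and C: "X \<subseteq> (\<Union>n. C n)" "\<And>n. bounded (C n)"
  shows "ennreal c \<le> (\<Sum>n. ennreal (diameter (C n) powr t))"
proof (rule ennreal_le_epsilon)
  fix e :: real assume e: "e > 0"
  have "\<exists>r>0. (diameter (C n) + 2 * r) powr t \<le> diameter (C n) powr t + e * (1/2) ^ Suc n" for n
  proof -
    have "((\<lambda>r. (diameter (C n) + 2 * r) powr t) \<longlongrightarrow> (diameter (C n) + 2 * 0) powr t) (at_right 0)"
      using t diameter_ge_0[OF C(2)[of n]]
      by (intro tendsto_powr' tendsto_intros) (auto simp: eventually_at_right_less intro!: eventually_at_rightI[of 0 1])
    moreover have "(diameter (C n) + 2 * 0) powr t < diameter (C n) powr t + e * (1/2) ^ Suc n" using e by simp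
    ultimately have "\<forall>\<^sub>F r in at_right 0. (diameter (C n) + 2 * r) powr t < diameter (C n) powr t + e * (1/2) ^ Suc n"
      by (rule order_tendstoD)
    hence "\<forall>\<^sub>F r in at_right 0. (diameter (C n) + 2 * r) powr t < diameter (C n) powr t + e * (1/2) ^ Suc n \<and> 0 < r"
      by (intro eventually_conj eventually_at_right_less)
    from eventually_happens[OF this] show ?thesis by (auto intro: less_imp_le)
  qed
  then obtain r where r: "\<And>n. r n > 0"
    and rt: "\<And>n. (diameter (C n) + 2 * r n) powr t \<le> diameter (C n) powr t + e * (1/2) ^ Suc n"
    by metis
  define D where "D = (\<lambda>n. \<Union>y\<in>C n. ball y (r n))"
  have D: "bounded (D n) \<and> diameter (D n) \<le> diameter (C n) + 2 * r n" for n
  proof (rule diameter_leI)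
    show "0 \<le> diameter (C n) + 2 * r n" using diameter_ge_0[OF C(2)[of n]] r[of n] by simp
    fix x y assume "x \<in> D n" "y \<in> D n"
    then obtain u v where uv: "u \<in> C n" "v \<in> C n" "dist u x < r n" "dist v y < r n" by (auto simp: D_def)
    have "dist u v \<le> diameter (C n)" using C(2) uv by (intro diameter_bounded_bound)
    thus "dist x y \<le> diameter (C n) + 2 * r n"
      using uv dist_triangle[of x y u] dist_triangle[of u y v] by (simp add: dist_commute)
  qed
  have CD: "C n \<subseteq> D n" for n using r[of n] centre_in_ball by (force simp: D_def)
  have XD: "X \<subseteq> (\<Union>n\<in>UNIV. D n)" by (rule order_trans[OF C(1) UN_mono[OF order_refl CD]])
  have "open (D n)" for n unfolding D_def by (intro open_UN ballI open_ball)
  with XD obtain N where N: "finite N" "X \<subseteq> (\<Union>n\<in>N. D n)"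
    using compactE_image[OF X _ XD] by metis
  have "c \<le> (\<Sum>n\<in>N. diameter (D n) powr t)" using fin[OF N] D by blast
  also have "\<dots> \<le> (\<Sum>n\<in>N. diameter (C n) powr t + e * (1/2) ^ Suc n)"
    using D t by (intro sum_mono order_trans[OF powr_mono2 rt]) (auto intro!: diameter_ge_0)
  also have "\<dots> = (\<Sum>n\<in>N. diameter (C n) powr t) + e * (\<Sum>n\<in>N. (1/2) ^ Suc n)"
    by (simp add: sum.distrib sum_distrib_left)
  also have "(\<Sum>n\<in>N. (1/2::real) ^ Suc n) \<le> 1"
    using sum_le_suminf[OF _ N(1), of "\<lambda>n. (1/2::real) ^ Suc n"] power_half_series
    by (auto simp: sums_iff)
  finally have "c \<le> (\<Sum>n\<in>N. diameter (C n) powr t) + e" using e by simp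
  hence "ennreal c \<le> ennreal ((\<Sum>n\<in>N. diameter (C n) powr t) + e)" by (rule ennreal_leI)
  also have "\<dots> = (\<Sum>n\<in>N. ennreal (diameter (C n) powr t)) + ennreal e"
    using e by (simp add: sum_nonneg ennreal_plus)
  also have "\<dots> \<le> (\<Sum>n. ennreal (diameter (C n) powr t)) + ennreal e"
    using N by (intro add_right_mono sum_le_suminf) auto
  finally show "ennreal c \<le> (\<Sum>n. ennreal (diameter (C n) powr t)) + ennreal e" .
qed

text \<open>Exponent 3 leaves a spare power of the mesh: \<open>(2 * k * p k)^2\<close> squares of
  diameter at most \<open>2 / p k\<close> contribute at most \<open>32 * k^2 / p k\<close>, which a
  large \<open>p k\<close> makes as small as desired.\<close>

lemma plane_cover_small_sum:
  fixes A :: "complex set"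
  assumes "\<delta> > 0" "e > 0"
  shows "\<exists>C. A \<subseteq> (\<Union>n. C n) \<and> (\<forall>n. bounded (C n) \<and> diameter (C n) \<le> \<delta>) \<and>
             (\<Sum>n. ennreal (diameter (C n) powr 3)) \<le> ennreal e"
proof -
  \<comment> \<open>The \<open>k\<close>-th layer is a grid of mesh \<open>1 / p k\<close> covering the square of side \<open>2 * k\<close> about 0.\<close>
  define p where "p = (\<lambda>k::nat. nat \<lceil>32 * real k ^ 2 * 2 ^ Suc k / e\<rceil> + nat \<lceil>2 / \<delta>\<rceil> + 1)"
  have p0: "real (p k) > 0" for k by (simp add: p_def)
  have p1: "32 * real k ^ 2 / p k \<le> e * (1/2) ^ Suc k" for k
  proof -
    have "32 * real k ^ 2 * 2 ^ Suc k / e \<le> p k" by (simp add: p_def)  linarith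
    hence "32 * real k ^ 2 * 2 ^ Suc k \<le> p k * e" using assms by (simp add: pos_divide_le_eq)
    thus ?thesis using p0[of k] by (simp add: field_simps power_divide)
  qed
  have p2: "2 / p k \<le> \<delta>" for k
  proof -
    have "2 / \<delta> \<le> p k" by (simp add: p_def) linarith
    thus ?thesis using p0[of k] assms by (simp add: field_simps)
  qed
  \<comment> \<open>Indices outside the grid give the empty set, of diameter 0, so all triples of
    natural numbers may be enumerated.\<close>
  define Sq where "Sq = (\<lambda>k i j. if i < 2 * k * p k \<and> j < 2 * k * p k then
      {z. i \<le> (Re z + k) * p k \<and> (Re z + k) * p k \<le> i + 1 \<and> j \<le> (Im z + k) * p k \<and> (Im z + k) * p k \<le> j + 1} else {})"
  define C where "C = (\<lambda>n. case prod_decode n of (k, m) \<Rightarrow> case prod_decode m of (i, j) \<Rightarrow> Sq k i j)"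
  have diam: "bounded (Sq k i j) \<and> diameter (Sq k i j) \<le> (if i < 2 * k * p k \<and> j < 2 * k * p k then 2 / p k else 0)" for k i j
  proof (rule diameter_leI)
    fix x y assume xy: "x \<in> Sq k i j" "y \<in> Sq k i j"
    hence ij: "i < 2 * k * p k \<and> j < 2 * k * p k" by (auto simp: Sq_def split: if_splits)
    have "\<bar>Re x - Re y\<bar> * p k \<le> 1" "\<bar>Im x - Im y\<bar> * p k \<le> 1"
      using xy ij p0[of k] by (auto simp: Sq_def abs_if algebra_simps split: if_splits)
    hence "\<bar>Re x - Re y\<bar> + \<bar>Im x - Im y\<bar> \<le> 2 / p k" using p0[of k] by (simp add: field_simps)
    thus "dist x y \<le> (if i < 2 * k * p k \<and> j < 2 * k * p k then 2 / p k else 0)"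
      using cmod_le[of "x - y"] ij by (simp add: dist_norm)
  qed auto
  have cover: "z \<in> (\<Union>n. C n)" for z
  proof -
    define k where "k = nat \<lceil>cmod z\<rceil> + 1"
    have "cmod z < k" unfolding k_def by linarith
    hence k: "\<bar>Re z\<bar> < k" "\<bar>Im z\<bar> < k" using abs_Re_le_cmod[of z] abs_Im_le_cmod[of z] by linarith+
    define i where "i = nat \<lfloor>(Re z + k) * p k\<rfloor>"
    define j where "j = nat \<lfloor>(Im z + k) * p k\<rfloor>"
    have nn: "0 \<le> (Re z + k) * p k" "0 \<le> (Im z + k) * p k" using k by auto
    have i: "real i \<le> (Re z + k) * p k" "(Re z + k) * p k < i + 1" and j: "real j \<le> (Im z + k) * p k" "(Im z + k) * p k < j + 1"
      using nn unfolding i_def j_def by linarith+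
    have "(Re z + k) * p k < (2 * real k) * real (p k)" "(Im z + k) * p k < (2 * real k) * real (p k)"
      using k p0[of k] by (auto intro!: mult_strict_right_mono)
    hence "real i < real (2 * k * p k)" "real j < real (2 * k * p k)" using i j by (auto simp: mult_ac)
    hence "i < 2 * k * p k" "j < 2 * k * p k" by (simp_all only: of_nat_less_iff)
    hence "z \<in> Sq k i j" using i j by (auto simp: Sq_def)
    hence "z \<in> C (prod_encode (k, prod_encode (i, j)))" by (simp add: C_def)
    thus ?thesis by blast
  qed
  have Cd: "bounded (C n) \<and> diameter (C n) \<le> \<delta>" for n
  proof -
    obtain k m where km: "prod_decode n = (k, m)" by (cases "prod_decode n")
    obtain i j where ij: "prod_decode m = (i, j)" by (cases "prod_decode m")
    show ?thesis using diam[of k i j] p2[of k] assms km ij by (auto simp: C_def split: if_splits)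
  qed
  define F where "F = (\<lambda>k i j. if i < 2 * k * p k \<and> j < 2 * k * p k then ennreal ((2 / p k) powr 3) else 0)"
  have "(\<Sum>n. ennreal (diameter (C n) powr 3)) \<le> (\<Sum>n. case prod_decode n of (k, m) \<Rightarrow> case prod_decode m of (i, j) \<Rightarrow> F k i j)"
  proof (intro suminf_le allI)
    fix n
    obtain k m where km: "prod_decode n = (k, m)" by (cases "prod_decode n")
    obtain i j where ij: "prod_decode m = (i, j)" by (cases "prod_decode m")
    show "ennreal (diameter (C n) powr 3) \<le> (case prod_decode n of (k, m) \<Rightarrow> case prod_decode m of (i, j) \<Rightarrow> F k i j)"
    proof (cases "i < 2 * k * p k \<and> j < 2 * k * p k")
      case True
      have "diameter (C n) powr 3 \<le> (2 / p k) powr 3"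
        using diam[of k i j] True km ij by (intro powr_mono2) (auto simp: C_def intro!: diameter_ge_0)
      thus ?thesis using True km ij by (simp add: F_def ennreal_leI)
    next
      case False
      hence "C n = {}" using km ij by (auto simp: C_def Sq_def)
      thus ?thesis by simp
    qed
  qed auto
  also have "\<dots> = (\<Sum>k. \<Sum>i. \<Sum>j. F k i j)"
  proof (rule suminf_ennreal_2dimen[of _ "\<lambda>(k, m). case prod_decode m of (i, j) \<Rightarrow> F k i j"])
    fix k
    have "(\<Sum>m. (\<lambda>(i, j). F k i j) (prod_decode m)) = (\<Sum>i. \<Sum>j. F k i j)"
      by (rule suminf_ennreal_2dimen) simp
    thus "(\<Sum>i. \<Sum>j. F k i j) = (\<Sum>m. case (k, m) of (k, m) \<Rightarrow> case prod_decode m of (i, j) \<Rightarrow> F k i j)" by simp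
  qed
  also have "\<dots> \<le> (\<Sum>k. ennreal (e * (1/2) ^ Suc k))"
  proof (intro suminf_le allI)
    fix k
    define M where "M = 2 * k * p k"
    have "(\<Sum>i. \<Sum>j. F k i j) = (\<Sum>i. if i < M then \<Sum>j\<in>{..<M}. ennreal ((2 / p k) powr 3) else 0)"
    proof (rule arg_cong[where f = suminf], rule ext)
      fix i
      show "(\<Sum>j. F k i j) = (if i < M then \<Sum>j\<in>{..<M}. ennreal ((2 / p k) powr 3) else 0)"
      proof (cases "i < M")
        case True
        have "(\<Sum>j. F k i j) = (\<Sum>j\<in>{..<M}. F k i j)"
          by (rule suminf_finite) (auto simp: F_def M_def)
        thus ?thesis using True by (simp add: F_def M_def)
      qed (simp add: F_def M_def)
    qed
    also have "\<dots> = (\<Sum>i\<in>{..<M}. if i < M then \<Sum>j\<in>{..<M}. ennreal ((2 / p k) powr 3) else 0)"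
      by (rule suminf_finite) auto
    also have "\<dots> = of_nat M * (of_nat M * ennreal ((2 / p k) powr 3))" by simp
    also have "\<dots> = ennreal (M * (M * (2 / p k) powr 3))"
      by (simp add: ennreal_mult ennreal_of_nat_eq_real_of_nat)
    also have "M * (M * (2 / p k) powr 3) = 32 * real k ^ 2 / p k"
      using p0[of k] by (simp add: M_def powr_numeral power_divide power2_eq_square power3_eq_cube field_simps)
    also have "ennreal \<dots> \<le> ennreal (e * (1/2) ^ Suc k)" using p1 by (rule ennreal_leI)
    finally show "(\<Sum>i. \<Sum>j. F k i j) \<le> ennreal (e * (1/2) ^ Suc k)" .
  qed auto
  also have "\<dots> = ennreal e"
    using sums_mult[OF power_half_series, of e] assms by (intro sums_unique[symmetric]) (auto simp: sums_ennreal)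
  finally have "(\<Sum>n. ennreal (diameter (C n) powr 3)) \<le> ennreal e" .
  moreover have "A \<subseteq> (\<Union>n. C n)" by (rule subsetI, rule cover)
  ultimately show ?thesis using Cd by (intro exI[of _ C] conjI) auto
qed

text \<open>The dimension is an infimum of real numbers, and a lower bound for it requires at least
  one exponent of measure zero.\<close>

lemma hausdorff_measure_plane_3: "hausdorff_measure 3 (A :: complex set) = 0"
proof -
  have small: "hausdorff_content 3 \<delta> A \<le> ennreal e" if pos: "\<delta> > 0" "e > 0" for \<delta> e
  proof -
    obtain C where C: "A \<subseteq> (\<Union>n. C n)" "\<forall>n. bounded (C n) \<and> diameter (C n) \<le> \<delta>"
      and sum: "(\<Sum>n. ennreal (diameter (C n) powr 3)) \<le> ennreal e"
      using plane_cover_small_sum[OF pos] by blast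
    show ?thesis unfolding hausdorff_content_def by (rule INF_lower2[where i = C]) (use C sum in auto)
  qed
  have "hausdorff_content 3 \<delta> A \<le> 0" if "\<delta> > 0" for \<delta>
    by (rule ennreal_le_epsilon) (use that small in simp)
  thus ?thesis by (auto simp: hausdorff_measure_def)
qed

text \<open>This carries the finite covering bound from the logarithmic coordinate to the plane:
  covers of \<open>A\<close> pull back under \<open>\<phi>\<close> to covers of \<open>X\<close>,
  with diameters enlarged by at most the factor \<open>\<kappa>\<close>.\<close>

lemma hausdorff_dim_ge:
  fixes X :: "'a::metric_space set" and \<phi> :: "'a \<Rightarrow> complex"
  assumes X: "compact X" and t: "t > 0" and c: "c > 0" and \<kappa>: "\<kappa> > 0"
    and fin: "\<And>(N :: nat set) D :: nat \<Rightarrow> 'a set. finite N \<Longrightarrow> X \<subseteq> (\<Union>n\<in>N. D n) \<Longrightarrow> (\<And>n. n \<in> N \<Longrightarrow> bounded (D n)) \<Longrightarrow>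
               c \<le> (\<Sum>n\<in>N. diameter (D n) powr t)"
    and \<phi>: "\<phi> ` X \<subseteq> A" "\<And>x y. x \<in> X \<Longrightarrow> y \<in> X \<Longrightarrow> dist x y \<le> \<kappa> * dist (\<phi> x) (\<phi> y)"
  shows "t \<le> hausdorff_dim A"
  unfolding hausdorff_dim_def
proof (rule cInf_greatest)
  show "{s. 0 \<le> s \<and> hausdorff_measure s A = 0} \<noteq> {}" using hausdorff_measure_plane_3[of A] by force
  fix s assume s: "s \<in> {s. 0 \<le> s \<and> hausdorff_measure s A = 0}"
  show "t \<le> s"
  proof (rule ccontr)
    assume st: "\<not> t \<le> s"
    \<comment> \<open>Scale 1 suffices: a diameter \<open>d \<le> 1\<close> satisfies
      \<open>d powr t \<le> d powr s\<close> when \<open>s < t\<close>, so the bound at exponent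
      \<open>t\<close> forces positive measure at exponent \<open>s\<close>.\<close>
    have "ennreal (c / \<kappa> powr t) \<le> hausdorff_content s 1 A"
      unfolding hausdorff_content_def
    proof (rule INF_greatest, clarify)
      fix C :: "nat \<Rightarrow> complex set" assume C: "A \<subseteq> (\<Union>n. C n)" "\<forall>n. bounded (C n) \<and> diameter (C n) \<le> 1"
      define D where "D = (\<lambda>n. {x \<in> X. \<phi> x \<in> C n})"
      have D: "bounded (D n) \<and> diameter (D n) \<le> \<kappa> * diameter (C n)" for n
      proof (rule diameter_leI)
        show "0 \<le> \<kappa> * diameter (C n)" using \<kappa> C by (auto intro!: mult_nonneg_nonneg diameter_ge_0)
        fix x y assume xy: "x \<in> D n" "y \<in> D n"
        hence "dist x y \<le> \<kappa> * dist (\<phi> x) (\<phi> y)" by (auto simp: D_def intro!: \<phi>)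
        also have "\<dots> \<le> \<kappa> * diameter (C n)"
          using xy \<kappa> C by (intro mult_left_mono diameter_bounded_bound) (auto simp: D_def)
        finally show "dist x y \<le> \<kappa> * diameter (C n)" .
      qed
      have Dcover: "X \<subseteq> (\<Union>n. D n)"
      proof
        fix x assume x: "x \<in> X"
        then obtain n where "\<phi> x \<in> C n" using C(1) \<phi>(1) by blast
        thus "x \<in> (\<Union>n. D n)" using x by (auto simp: D_def)
      qed
      have "ennreal c \<le> (\<Sum>n. ennreal (diameter (D n) powr t))"
        by (rule countable_cover_sum_ge[OF X t fin]) (use D Dcover in auto)
      also have "\<dots> \<le> (\<Sum>n. ennreal (\<kappa> powr t) * ennreal (diameter (C n) powr s))"
      proof (intro suminf_le allI)
        fix n
        have d: "0 \<le> diameter (C n)" "diameter (C n) \<le> 1" using C by (auto intro!: diameter_ge_0)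
        have "diameter (D n) powr t \<le> (\<kappa> * diameter (C n)) powr t"
          using D t by (intro powr_mono2) (auto intro!: diameter_ge_0)
        also have "\<dots> = \<kappa> powr t * diameter (C n) powr t" using \<kappa> d by (intro powr_mult)
        also have "\<dots> \<le> \<kappa> powr t * diameter (C n) powr s"
          using d st by (intro mult_left_mono powr_mono') auto
        finally show "ennreal (diameter (D n) powr t) \<le> ennreal (\<kappa> powr t) * ennreal (diameter (C n) powr s)"
          by (simp add: ennreal_mult[symmetric] ennreal_leI)
      qed auto
      also have "\<dots> = ennreal (\<kappa> powr t) * (\<Sum>n. ennreal (diameter (C n) powr s))" by (rule ennreal_suminf_cmult)
      finally have "ennreal (1 / \<kappa> powr t) * ennreal c \<le>
          ennreal (1 / \<kappa> powr t) * (ennreal (\<kappa> powr t) * (\<Sum>n. ennreal (diameter (C n) powr s)))"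
        by (rule mult_left_mono) simp
      also have "\<dots> = (ennreal (1 / \<kappa> powr t) * ennreal (\<kappa> powr t)) * (\<Sum>n. ennreal (diameter (C n) powr s))"
        by (simp only: mult.assoc)
      also have "ennreal (1 / \<kappa> powr t) * ennreal (\<kappa> powr t) = 1"
        using \<kappa> by (simp flip: ennreal_mult)
      finally show "ennreal (c / \<kappa> powr t) \<le> (\<Sum>n. ennreal (diameter (C n) powr s))"
        using c by (simp flip: ennreal_mult)
    qed
    also have "\<dots> \<le> hausdorff_measure s A"
      unfolding hausdorff_measure_def by (rule SUP_upper) simp
    also have "\<dots> = 0" using s by simp
    finally have "c / \<kappa> powr t \<le> 0" by (simp add: ennreal_eq_0_iff)
    moreover have "0 < c / \<kappa> powr t" using c \<kappa> by simp
    ultimately show False by linarith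
  qed
qed

section \<open>Systems of inverse branches\<close>

text \<open>A triple \<open>(h, b, v)\<close> consists of an inverse branch \<open>h\<close> of the \<open>n\<close>-th iterate of \<open>f\<close>, read in the
  logarithmic coordinate \<open>exp\<close>, a lower Lipschitz constant \<open>b\<close>, and the centre \<open>v\<close> of a unit disc into
  which \<open>h\<close> maps the unit disc about \<open>a\<close>.\<close>
definition branch_system ::
  "(complex \<Rightarrow> complex) \<Rightarrow> nat \<Rightarrow> complex \<Rightarrow> ((complex \<Rightarrow> complex) \<times> real \<times> complex) set \<Rightarrow> bool" where
  "branch_system f n a \<Phi> \<longleftrightarrow> finite \<Phi> \<and>
     (\<forall>(h, b, v)\<in>\<Phi>. 0 < b \<and> b \<le> 1/2 \<and> h ` cball a 1 \<subseteq> cball v 1 \<and>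
        (\<forall>x\<in>cball a 1. \<forall>y\<in>cball a 1. b * dist x y \<le> dist (h x) (h y) \<and> dist (h x) (h y) \<le> dist x y / 2) \<and>
        (\<forall>x\<in>cball a 1. (fstep f ^^ n) (Some (exp (h x))) = Some (exp x))) \<and>
     (\<forall>\<phi>\<in>\<Phi>. \<forall>\<psi>\<in>\<Phi>. \<forall>x\<in>cball a 1. \<forall>y\<in>cball a 1. exp (fst \<phi> x) = exp (fst \<psi> y) \<longrightarrow> \<phi> = \<psi> \<and> x = y)"

abbreviation target :: "(complex \<Rightarrow> complex) \<times> real \<times> complex \<Rightarrow> complex" where
  "target \<phi> \<equiv> snd (snd \<phi>)"

abbreviation ratio :: "(complex \<Rightarrow> complex) \<times> real \<times> complex \<Rightarrow> real" where
  "ratio \<phi> \<equiv> fst (snd \<phi>)"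

text \<open>The left-hand side of Moran's equation for the contraction ratios; for a system
  returning to its own disc, a value of at least 1 forces dimension at least
  \<open>t\<close>.\<close>

definition weight :: "real \<Rightarrow> ((complex \<Rightarrow> complex) \<times> real \<times> complex) set \<Rightarrow> real" where
  "weight t \<Phi> = (\<Sum>\<phi>\<in>\<Phi>. ratio \<phi> powr t)"

lemma branch_systemD:
  assumes "branch_system f n a \<Phi>" "\<phi> \<in> \<Phi>"
  shows "0 < ratio \<phi>" "ratio \<phi> \<le> 1/2" "fst \<phi> ` cball a 1 \<subseteq> cball (target \<phi>) 1"
    "\<And>x y. x \<in> cball a 1 \<Longrightarrow> y \<in> cball a 1 \<Longrightarrow> ratio \<phi> * dist x y \<le> dist (fst \<phi> x) (fst \<phi> y)"
    "\<And>x y. x \<in> cball a 1 \<Longrightarrow> y \<in> cball a 1 \<Longrightarrow> dist (fst \<phi> x) (fst \<phi> y) \<le> dist x y / 2"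
    "\<And>x. x \<in> cball a 1 \<Longrightarrow> (fstep f ^^ n) (Some (exp (fst \<phi> x))) = Some (exp x)"
proof -
  have "case \<phi> of (h, b, v) \<Rightarrow> 0 < b \<and> b \<le> 1/2 \<and> h ` cball a 1 \<subseteq> cball v 1 \<and>
        (\<forall>x\<in>cball a 1. \<forall>y\<in>cball a 1. b * dist x y \<le> dist (h x) (h y) \<and> dist (h x) (h y) \<le> dist x y / 2) \<and>
        (\<forall>x\<in>cball a 1. (fstep f ^^ n) (Some (exp (h x))) = Some (exp x))"
    using assms unfolding branch_system_def by blast
  then show "0 < ratio \<phi>" "ratio \<phi> \<le> 1/2" "fst \<phi> ` cball a 1 \<subseteq> cball (target \<phi>) 1"
    "\<And>x y. x \<in> cball a 1 \<Longrightarrow> y \<in> cball a 1 \<Longrightarrow> ratio \<phi> * dist x y \<le> dist (fst \<phi> x) (fst \<phi> y)"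
    "\<And>x y. x \<in> cball a 1 \<Longrightarrow> y \<in> cball a 1 \<Longrightarrow> dist (fst \<phi> x) (fst \<phi> y) \<le> dist x y / 2"
    "\<And>x. x \<in> cball a 1 \<Longrightarrow> (fstep f ^^ n) (Some (exp (fst \<phi> x))) = Some (exp x)"
    unfolding case_prod_unfold by blast+
qed

lemma branch_system_inj:
  assumes "branch_system f n a \<Phi>" "\<phi> \<in> \<Phi>" "\<psi> \<in> \<Phi>" "x \<in> cball a 1" "y \<in> cball a 1" "exp (fst \<phi> x) = exp (fst \<psi> y)"
  shows "\<phi> = \<psi> \<and> x = y"
  using assms unfolding branch_system_def by blast

lemma branch_system_subset: "branch_system f n a \<Phi> \<Longrightarrow> \<Psi> \<subseteq> \<Phi> \<Longrightarrow> branch_system f n a \<Psi>"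
  unfolding branch_system_def by (blast intro: finite_subset)

lemma branch_system_finite: "branch_system f n a \<Phi> \<Longrightarrow> finite \<Phi>"
  unfolding branch_system_def by blast

text \<open>A branch \<open>\<phi>\<close> lands in the disc on which the branches in
  \<open>\<Psi> (target \<phi>)\<close> are defined. In \<open>\<psi> \<circ> \<phi>\<close> the map
  \<open>f\<close> undoes \<open>\<psi>\<close> in \<open>n\<close> steps and then
  \<open>\<phi>\<close> in \<open>m\<close> steps. Ratios multiply, hence the factor
  \<open>L\<close> for the weight.\<close>

lemma branch_system_compose:
  assumes \<Phi>: "branch_system f m a \<Phi>" and \<Psi>: "\<And>\<phi>. \<phi> \<in> \<Phi> \<Longrightarrow> branch_system f n (target \<phi>) (\<Psi> (target \<phi>))"
    and w: "\<And>\<phi>. \<phi> \<in> \<Phi> \<Longrightarrow> L \<le> weight t (\<Psi> (target \<phi>))"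
  obtains \<Theta> where "branch_system f (m + n) a \<Theta>" "L * weight t \<Phi> \<le> weight t \<Theta>"
    "\<And>\<theta>. \<theta> \<in> \<Theta> \<Longrightarrow> \<exists>\<phi>\<in>\<Phi>. \<exists>\<psi>\<in>\<Psi> (target \<phi>). target \<theta> = target \<psi>"
proof -
  define P where "P = (SIGMA \<phi>:\<Phi>. \<Psi> (target \<phi>))"
  define comp :: "((complex \<Rightarrow> complex) \<times> real \<times> complex) \<times> ((complex \<Rightarrow> complex) \<times> real \<times> complex) \<Rightarrow> ((complex \<Rightarrow> complex) \<times> real \<times> complex)"
    where "comp = (\<lambda>(\<phi>, \<psi>). (fst \<psi> \<circ> fst \<phi>, ratio \<psi> * ratio \<phi>, target \<psi>))"
  have mem: "fst \<phi> x \<in> cball (target \<phi>) 1" if "\<phi> \<in> \<Phi>" "x \<in> cball a 1" for \<phi> x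
    using branch_systemD(3)[OF \<Phi> that(1)] that(2) by blast
  \<comment> \<open>Applying \<open>n\<close> steps of \<open>f\<close> to a coincidence removes the
    outer branches and leaves one in \<open>\<Phi>\<close>; once the inner branches agree,
    injectivity of the outer system applies.\<close>
  have inj: "(\<phi>, \<psi>) = (\<phi>', \<psi>') \<and> x = y"
    if "\<phi> \<in> \<Phi>" "\<psi> \<in> \<Psi> (target \<phi>)" "\<phi>' \<in> \<Phi>" "\<psi>' \<in> \<Psi> (target \<phi>')" and x: "x \<in> cball a 1" and y: "y \<in> cball a 1"
      and eq: "exp (fst \<psi> (fst \<phi> x)) = exp (fst \<psi>' (fst \<phi>' y))" for \<phi> \<psi> \<phi>' \<psi>' x y
  proof -
    have "Some (exp (fst \<phi> x)) = Some (exp (fst \<phi>' y))"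
      using branch_systemD(6)[OF \<Psi> that(2) mem, OF that(1) that(1) x]
            branch_systemD(6)[OF \<Psi> that(4) mem, OF that(3) that(3) y] eq by simp
    hence e: "\<phi> = \<phi>'" "x = y" using branch_system_inj[OF \<Phi> that(1,3) x y] by auto
    moreover have "\<psi> = \<psi>'"
      using branch_system_inj[OF \<Psi>[OF that(1)] that(2) _ mem[OF that(1) x] mem[OF that(1) y]] that(4) eq e by auto
    ultimately show ?thesis by simp
  qed
  have comp_inj: "inj_on comp P"
  proof (rule inj_onI)
    fix p q assume pq: "p \<in> P" "q \<in> P" "comp p = comp q"
    hence "(fst (snd p) \<circ> fst (fst p)) a = (fst (snd q) \<circ> fst (fst q)) a"
      by (auto simp: comp_def case_prod_unfold)
    thus "p = q" using inj[of "fst p" "snd p" "fst q" "snd q" a a] pq(1,2) by (auto simp: P_def)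
  qed
  have finP: "finite P" unfolding P_def using \<Phi> \<Psi> by (auto intro!: finite_SigmaI dest: branch_system_finite)
  show thesis
  proof
    show "branch_system f (m + n) a (comp ` P)"
      unfolding branch_system_def
    proof (intro conjI ballI impI)
      show "finite (comp ` P)" using finP by simp
      fix \<theta> assume "\<theta> \<in> comp ` P"
      then obtain \<phi> \<psi> where \<phi>: "\<phi> \<in> \<Phi>" and \<psi>: "\<psi> \<in> \<Psi> (target \<phi>)"
        and \<theta>: "\<theta> = (fst \<psi> \<circ> fst \<phi>, ratio \<psi> * ratio \<phi>, target \<psi>)"
        by (auto simp: P_def comp_def)
      note D = branch_systemD[OF \<Phi> \<phi>] and E = branch_systemD[OF \<Psi>[OF \<phi>] \<psi>] and mem' = mem[OF \<phi>]
      have "ratio \<psi> * ratio \<phi> \<le> 1/2 * 1" using D E by (intro mult_mono) auto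
      moreover have "(ratio \<psi> * ratio \<phi>) * dist x y \<le> dist (fst \<psi> (fst \<phi> x)) (fst \<psi> (fst \<phi> y)) \<and>
          dist (fst \<psi> (fst \<phi> x)) (fst \<psi> (fst \<phi> y)) \<le> dist x y / 2"
        if "x \<in> cball a 1" "y \<in> cball a 1" for x y
      proof
        have "(ratio \<psi> * ratio \<phi>) * dist x y = ratio \<psi> * (ratio \<phi> * dist x y)" by simp
        also have "\<dots> \<le> ratio \<psi> * dist (fst \<phi> x) (fst \<phi> y)"
          using E(1) D(4)[OF that] by (intro mult_left_mono) auto
        also have "\<dots> \<le> dist (fst \<psi> (fst \<phi> x)) (fst \<psi> (fst \<phi> y))" using E(4) mem' that by blast
        finally show "(ratio \<psi> * ratio \<phi>) * dist x y \<le> dist (fst \<psi> (fst \<phi> x)) (fst \<psi> (fst \<phi> y))" .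
        have "dist (fst \<psi> (fst \<phi> x)) (fst \<psi> (fst \<phi> y)) \<le> dist (fst \<phi> x) (fst \<phi> y) / 2" using E(5) mem' that by blast
        also have "\<dots> \<le> dist x y / 2" using D(5)[OF that] zero_le_dist[of x y] by linarith
        finally show "dist (fst \<psi> (fst \<phi> x)) (fst \<psi> (fst \<phi> y)) \<le> dist x y / 2" .
      qed
      moreover have "(fst \<psi> \<circ> fst \<phi>) ` cball a 1 \<subseteq> cball (target \<psi>) 1"
        using E(3) mem' by (auto simp: image_comp[symmetric])
      moreover have "(fstep f ^^ (m + n)) (Some (exp (fst \<psi> (fst \<phi> x)))) = Some (exp x)" if "x \<in> cball a 1" for x
        using E(6)[OF mem'[OF that]] D(6)[OF that] by (simp add: funpow_add)
      moreover have "0 < ratio \<psi> * ratio \<phi>" using D(1) E(1) by simp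
      ultimately show "case \<theta> of (h, b, v) \<Rightarrow> 0 < b \<and> b \<le> 1/2 \<and> h ` cball a 1 \<subseteq> cball v 1 \<and>
        (\<forall>x\<in>cball a 1. \<forall>y\<in>cball a 1. b * dist x y \<le> dist (h x) (h y) \<and> dist (h x) (h y) \<le> dist x y / 2) \<and>
        (\<forall>x\<in>cball a 1. (fstep f ^^ (m + n)) (Some (exp (h x))) = Some (exp x))"
        unfolding \<theta> prod.case by (simp del: mem_cball)
    next
      fix \<theta> \<theta>' x y
      assume "\<theta> \<in> comp ` P" "\<theta>' \<in> comp ` P" and xy: "x \<in> cball a 1" "y \<in> cball a 1"
        and eq: "exp (fst \<theta> x) = exp (fst \<theta>' y)"
      then obtain p q where pq: "p \<in> P" "q \<in> P" "\<theta> = comp p" "\<theta>' = comp q" by blast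
      have "p = q \<and> x = y"
        using inj[of "fst p" "snd p" "fst q" "snd q" x y] pq xy eq by (auto simp: P_def comp_def case_prod_unfold)
      thus "\<theta> = \<theta>'" "x = y" using pq by auto
    qed
    have "L * weight t \<Phi> = (\<Sum>\<phi>\<in>\<Phi>. ratio \<phi> powr t * L)"
      by (simp add: weight_def sum_distrib_left mult.commute)
    also have "\<dots> \<le> (\<Sum>\<phi>\<in>\<Phi>. ratio \<phi> powr t * weight t (\<Psi> (target \<phi>)))"
      using w by (intro sum_mono mult_left_mono) auto
    also have "\<dots> = (\<Sum>\<phi>\<in>\<Phi>. \<Sum>\<psi>\<in>\<Psi> (target \<phi>). (ratio \<psi> * ratio \<phi>) powr t)"
    proof (rule sum.cong[OF refl])
      fix \<phi> assume \<phi>: "\<phi> \<in> \<Phi>"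
      have "ratio \<phi> powr t * weight t (\<Psi> (target \<phi>)) = (\<Sum>\<psi>\<in>\<Psi> (target \<phi>). ratio \<phi> powr t * ratio \<psi> powr t)"
        by (simp add: weight_def sum_distrib_left)
      also have "\<dots> = (\<Sum>\<psi>\<in>\<Psi> (target \<phi>). (ratio \<psi> * ratio \<phi>) powr t)"
      proof (rule sum.cong[OF refl])
        fix \<psi> assume \<psi>: "\<psi> \<in> \<Psi> (target \<phi>)"
        show "ratio \<phi> powr t * ratio \<psi> powr t = (ratio \<psi> * ratio \<phi>) powr t"
          using branch_systemD(1)[OF \<Phi> \<phi>] branch_systemD(1)[OF \<Psi>[OF \<phi>] \<psi>]
          by (simp add: powr_mult mult.commute)
      qed
      finally show "ratio \<phi> powr t * weight t (\<Psi> (target \<phi>)) = (\<Sum>\<psi>\<in>\<Psi> (target \<phi>). (ratio \<psi> * ratio \<phi>) powr t)" .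
    qed
    also have "\<dots> = (\<Sum>(\<phi>, \<psi>)\<in>P. (ratio \<psi> * ratio \<phi>) powr t)"
      unfolding P_def using \<Phi> \<Psi> by (intro sum.Sigma) (auto dest: branch_system_finite)
    also have "\<dots> = weight t (comp ` P)"
      unfolding weight_def by (subst sum.reindex[OF comp_inj]) (simp add: comp_def case_prod_unfold)
    finally show "L * weight t \<Phi> \<le> weight t (comp ` P)" .
    show "\<exists>\<phi>\<in>\<Phi>. \<exists>\<psi>\<in>\<Psi> (target \<phi>). target \<theta> = target \<psi>" if \<theta>: "\<theta> \<in> comp ` P" for \<theta>
    proof -
      obtain p where p: "p \<in> P" "\<theta> = comp p" using \<theta> by blast
      thus ?thesis
        by (intro bexI[of _ "fst p"] bexI[of _ "snd p"]) (auto simp: P_def comp_def case_prod_unfold)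
    qed
  qed
qed

text \<open>Every state has many branches in total, so after sufficiently many steps one target state
  collects weight at least 1. This choice of a target is a self-map of a finite set and hence has a cycle.\<close>
lemma branch_system_cycle:
  assumes V: "finite V" "V \<noteq> {}"
    and B: "\<And>v. v \<in> V \<Longrightarrow> branch_system f 1 v (B v)" "\<And>v \<phi>. v \<in> V \<Longrightarrow> \<phi> \<in> B v \<Longrightarrow> target \<phi> \<in> V"
      "\<And>v. v \<in> V \<Longrightarrow> 2 \<le> weight t (B v)"
  obtains n a \<Phi> where "branch_system f n a \<Phi>" "1 \<le> weight t \<Phi>" "\<And>\<phi>. \<phi> \<in> \<Phi> \<Longrightarrow> target \<phi> = a"
proof -
  \<comment> \<open>Counting starts with one step, because the identity contracts by no factor 1/2
    and so forms no branch system.\<close>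
  have iter: "\<exists>\<Phi>. branch_system f (Suc n) v \<Phi> \<and> (\<forall>\<phi>\<in>\<Phi>. target \<phi> \<in> V) \<and> 2 ^ Suc n \<le> weight t \<Phi>" if "v \<in> V" for n v
  proof (induction n)
    case 0
    thus ?case using B[OF that] by auto
  next
    case (Suc n)
    then obtain \<Phi> where \<Phi>: "branch_system f (Suc n) v \<Phi>" "\<forall>\<phi>\<in>\<Phi>. target \<phi> \<in> V" "2 ^ Suc n \<le> weight t \<Phi>" by blast
    obtain \<Theta> where \<Theta>: "branch_system f (Suc n + 1) v \<Theta>" "2 * weight t \<Phi> \<le> weight t \<Theta>"
      "\<And>\<theta>. \<theta> \<in> \<Theta> \<Longrightarrow> \<exists>\<phi>\<in>\<Phi>. \<exists>\<psi>\<in>B (target \<phi>). target \<theta> = target \<psi>"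
      by (rule branch_system_compose[OF \<Phi>(1), of 1 B 2 t]) (use B \<Phi>(2) in auto)
    have "\<forall>\<theta>\<in>\<Theta>. target \<theta> \<in> V" using \<Theta>(3) B(2) \<Phi>(2) by fastforce
    thus ?case using \<Theta>(1,2) \<Phi>(3) by (intro exI[of _ \<Theta>]) auto
  qed
  \<comment> \<open>Now \<open>2 ^ N\<close> exceeds the number of targets, so grouping by target
    leaves one group of weight at least 1.\<close>
  define N where "N = Suc (card V)"
  have "\<exists>w\<in>V. \<exists>\<Phi>. branch_system f N v \<Phi> \<and> (\<forall>\<phi>\<in>\<Phi>. target \<phi> = w) \<and> 1 \<le> weight t \<Phi>" if v: "v \<in> V" for v
  proof -
    obtain \<Phi> where \<Phi>: "branch_system f N v \<Phi>" "\<forall>\<phi>\<in>\<Phi>. target \<phi> \<in> V" "2 ^ N \<le> weight t \<Phi>"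
      using iter[OF v, of "card V"] by (auto simp: N_def)
    define R where "R = (\<lambda>w. {\<phi> \<in> \<Phi>. target \<phi> = w})"
    have "weight t \<Phi> = (\<Sum>w\<in>V. weight t (R w))"
      unfolding weight_def R_def
      by (rule sum.group[symmetric]) (use \<Phi> V branch_system_finite in auto)
    moreover have "real (card V) < 2 ^ N" unfolding N_def
      by (metis less_exp of_nat_less_two_power order_less_trans lessI of_nat_less_iff)
    moreover have "(\<Sum>w\<in>V. 1) = real (card V)" by simp
    ultimately have "(\<Sum>w\<in>V. 1) < (\<Sum>w\<in>V. weight t (R w))" using \<Phi>(3) by linarith
    then obtain w where w: "w \<in> V" "1 \<le> weight t (R w)"
      by (metis sum_mono linorder_not_less linorder_le_cases)
    have "branch_system f N v (R w)" by (rule branch_system_subset[OF \<Phi>(1)]) (auto simp: R_def)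
    moreover have "\<forall>\<phi>\<in>R w. target \<phi> = w" by (simp add: R_def)
    ultimately show ?thesis using w by blast
  qed
  then obtain j \<Psi> where j: "\<And>v. v \<in> V \<Longrightarrow> j v \<in> V" and \<Psi>: "\<And>v. v \<in> V \<Longrightarrow> branch_system f N v (\<Psi> v)"
    "\<And>v \<phi>. v \<in> V \<Longrightarrow> \<phi> \<in> \<Psi> v \<Longrightarrow> target \<phi> = j v" "\<And>v. v \<in> V \<Longrightarrow> 1 \<le> weight t (\<Psi> v)"
    by metis
  have jV: "(j ^^ k) v \<in> V" if "v \<in> V" for k v using that j by (induction k) auto
  have chain: "\<exists>\<Phi>. branch_system f (Suc k * N) v \<Phi> \<and> (\<forall>\<phi>\<in>\<Phi>. target \<phi> = (j ^^ Suc k) v) \<and> 1 \<le> weight t \<Phi>"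
    if v: "v \<in> V" for k v
  proof (induction k)
    case 0
    thus ?case using \<Psi>[OF v] by auto
  next
    case (Suc k)
    then obtain \<Phi> where \<Phi>: "branch_system f (Suc k * N) v \<Phi>" "\<forall>\<phi>\<in>\<Phi>. target \<phi> = (j ^^ Suc k) v" "1 \<le> weight t \<Phi>" by blast
    obtain \<Theta> where \<Theta>: "branch_system f (Suc k * N + N) v \<Theta>" "1 * weight t \<Phi> \<le> weight t \<Theta>"
      "\<And>\<theta>. \<theta> \<in> \<Theta> \<Longrightarrow> \<exists>\<phi>\<in>\<Phi>. \<exists>\<psi>\<in>\<Psi> (target \<phi>). target \<theta> = target \<psi>"
      by (rule branch_system_compose[OF \<Phi>(1), of N \<Psi> 1 t]) (use \<Psi> \<Phi>(2) jV[OF v, of "Suc k"] in auto)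
    have "\<forall>\<theta>\<in>\<Theta>. target \<theta> = (j ^^ Suc (Suc k)) v"
    proof
      fix \<theta> assume "\<theta> \<in> \<Theta>"
      then obtain \<phi> \<psi> where "\<phi> \<in> \<Phi>" "\<psi> \<in> \<Psi> (target \<phi>)" "target \<theta> = target \<psi>" using \<Theta>(3) by blast
      thus "target \<theta> = (j ^^ Suc (Suc k)) v" using \<Phi>(2) \<Psi>(2)[OF jV[OF v, of "Suc k"]] by auto
    qed
    thus ?case using \<Theta>(1,2) \<Phi>(3) by (intro exI[of _ \<Theta>]) (auto simp: add.commute)
  qed
  obtain v0 where v0: "v0 \<in> V" using V by blast
  \<comment> \<open>An orbit of \<open>j\<close> with \<open>card V + 1\<close> members in
    \<open>V\<close> repeats; the period \<open>q - p\<close> is positive, as \<open>chain\<close>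
    requires.\<close>
  have "\<not> inj_on (\<lambda>k. (j ^^ k) v0) {..card V}"
  proof
    assume "inj_on (\<lambda>k. (j ^^ k) v0) {..card V}"
    hence "card {..card V} \<le> card V" using jV[OF v0] V by (intro card_inj_on_le) auto
    thus False by simp
  qed
  then obtain p' q' where "(j ^^ p') v0 = (j ^^ q') v0" "p' \<noteq> q'" unfolding inj_on_def by blast
  hence "\<exists>p q. p < q \<and> (j ^^ p) v0 = (j ^^ q) v0"
    by (metis linorder_neqE_nat)
  then obtain p q where pq: "p < q" "(j ^^ p) v0 = (j ^^ q) v0" by blast
  have "(j ^^ Suc (q - p - 1)) ((j ^^ p) v0) = (j ^^ (Suc (q - p - 1) + p)) v0" by (simp only: funpow_add o_apply)
  also have "Suc (q - p - 1) + p = q" using pq by simp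
  finally have "(j ^^ Suc (q - p - 1)) ((j ^^ p) v0) = (j ^^ p) v0" using pq by simp
  thus thesis using chain[OF jV[OF v0], of "q - p - 1" p] that by metis
qed

section \<open>The limit set lies in the Julia set\<close>

text \<open>Points of a unit disc differ by at most 2, which is less than \<open>2 \<pi>\<close>. So
  the difference quotient of \<open>exp\<close> at 0 has no zero on the closed disc of radius 2, and
  compactness gives a positive lower bound.\<close>

lemma exp_expands_on_cball:
  obtains \<kappa> where "\<kappa> > 0" "\<And>x y. x \<in> cball a 1 \<Longrightarrow> y \<in> cball a 1 \<Longrightarrow> dist x y \<le> \<kappa> * dist (exp x) (exp y :: complex)"
proof -
  define Q where "Q = (\<lambda>w::complex. if w = 0 then deriv exp 0 else (exp w - exp 0) / (w - 0))"
  have "Q holomorphic_on UNIV"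
    unfolding Q_def by (rule pole_lemma) (auto intro: holomorphic_intros)
  hence Qc: "continuous_on (cball 0 2) Q"
    by (auto intro: holomorphic_on_imp_continuous_on continuous_on_subset)
  have "\<exists>q\<in>cball 0 2. \<forall>w\<in>cball 0 2. cmod (Q q) \<le> cmod (Q w)"
    by (rule continuous_attains_inf) (auto intro!: continuous_intros Qc)
  then obtain q where q: "q \<in> cball 0 2" "\<And>w. w \<in> cball 0 2 \<Longrightarrow> cmod (Q q) \<le> cmod (Q w)" by blast
  have "Q q \<noteq> 0"
  proof
    assume Q0: "Q q = 0"
    have "deriv exp 0 = (1::complex)" by (rule DERIV_imp_deriv) (auto intro!: derivative_eq_intros)
    hence qn: "q \<noteq> 0" using Q0 by (auto simp: Q_def)
    hence "exp q = 1" using Q0 by (simp add: Q_def)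
    then obtain n :: int where n: "Re q = 0" "Im q = of_int (2 * n) * pi" by (auto simp: exp_eq_1)
    hence "n \<noteq> 0" using qn by (auto simp: complex_eq_iff)
    hence "1 \<le> \<bar>real_of_int n\<bar>" by linarith
    hence "2 * 3 \<le> (2 * \<bar>real_of_int n\<bar>) * pi" using pi_gt3 by (intro mult_mono) auto
    also have "\<dots> = \<bar>Im q\<bar>" using n by (simp add: abs_mult)
    also have "\<dots> \<le> 2" using abs_Im_le_cmod[of q] q(1) by simp
    finally show False by simp
  qed
  hence c: "cmod (Q q) > 0" by simp
  define \<kappa> where "\<kappa> = 1 / (exp (Re a - 1) * cmod (Q q))"
  show thesis
  proof
    show "\<kappa> > 0" using c by (simp add: \<kappa>_def)
    fix x y assume xy: "x \<in> cball a 1" "y \<in> cball a 1"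
    have "dist x y \<le> 2" using xy dist_triangle[of x y a] by (auto simp: dist_commute)
    hence "cmod (Q q) \<le> cmod (Q (x - y))" using q(2)[of "x - y"] by (simp add: dist_norm norm_minus_commute)
    hence "cmod (Q q) * cmod (x - y) \<le> cmod (exp (x - y) - 1)"
      by (cases "x = y") (auto simp: Q_def norm_divide field_simps)
    moreover have "exp (Re a - 1) \<le> cmod (exp y)"
      using xy(2) abs_Re_le_cmod[of "a - y"] by (auto simp: dist_norm)
    ultimately have "exp (Re a - 1) * (cmod (Q q) * cmod (x - y)) \<le> cmod (exp y) * cmod (exp (x - y) - 1)"
      by (intro mult_mono) auto
    also have "\<dots> = dist (exp x) (exp y)"
    proof -
      have "exp y * (exp (x - y) - 1) = exp x - exp y" by (simp add: right_diff_distrib exp_diff)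
      thus ?thesis by (simp only: dist_norm norm_mult[symmetric])
    qed
    finally show "dist x y \<le> \<kappa> * dist (exp x) (exp y)"
      using c by (simp add: \<kappa>_def dist_norm field_simps)
  qed
qed

section \<open>Stereographic projection and continuity of iterates\<close>

lemma continuous_on_stereo: "continuous_on A stereo"
proof -
  have "1 + (cmod z)\<^sup>2 \<noteq> 0" "(cmod z)\<^sup>2 + 1 \<noteq> 0" for z using zero_le_power2[of "cmod z"] by linarith+
  thus ?thesis unfolding stereo_def by (intro continuous_intros) auto
qed

lemma stereo_eq_imp_cmod_eq:
  assumes "stereo z = stereo w"
  shows "cmod z = cmod w"
proof -
  have "1 + (cmod z)\<^sup>2 > 0" "1 + (cmod w)\<^sup>2 > 0" by (auto intro: add_pos_nonneg)
  moreover have "((cmod z)^2 - 1) / ((cmod z)^2 + 1) = ((cmod w)^2 - 1) / ((cmod w)^2 + 1)"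
    using assms by (simp add: stereo_def)
  ultimately have "(cmod z)\<^sup>2 = (cmod w)\<^sup>2" by (simp add: frac_eq_eq add.commute) (simp add: algebra_simps)
  thus ?thesis by simp
qed

lemma continuous_on_iter:
  assumes f: "f nicely_meromorphic_on UNIV" and U: "\<And>n w. w \<in> U \<Longrightarrow> (fstep f ^^ n) (Some w) \<noteq> None"
  shows "continuous_on U (iter f n)"
proof (induction n)
  case 0
  have "iter f 0 = (\<lambda>z. z)" by (simp add: iter_def fun_eq_iff)
  thus ?case by simp
next
  case (Suc n)
  have step: "\<not> is_pole f (iter f n w) \<and> iter f (Suc n) w = f (iter f n w)" if w: "w \<in> U" for w
  proof -
    obtain z where z: "(fstep f ^^ n) (Some w) = Some z" using U[OF w, of n] by blast
    show ?thesis using U[OF w, of "Suc n"] z by (auto simp: iter_def fstep_def split: if_splits)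
  qed
  have "continuous_on (iter f n ` U) f"
  proof (rule continuous_at_imp_continuous_on, rule ballI)
    fix z assume "z \<in> iter f n ` U"
    hence "f analytic_on {z}"
      using step by (intro nicely_meromorphic_on_imp_analytic_at[OF f]) auto
    thus "isCont f z" by (rule analytic_at_imp_isCont)
  qed
  hence "continuous_on U (f \<circ> iter f n)" by (rule continuous_on_compose[OF Suc])
  thus ?case using step by (simp cong: continuous_on_cong)
qed

text \<open>A locally uniform limit of iterates would be continuous at the point, whereas arbitrarily small
  neighbourhoods of it are mapped onto a fixed disc.\<close>
lemma in_julia_setI:
  assumes f: "f nicely_meromorphic_on UNIV"
    and shrink: "\<And>n. \<exists>g m. x \<in> g ` cball a 1 \<and>
         (\<forall>y\<in>cball a 1. \<forall>z\<in>cball a 1. dist (g y) (g z) \<le> dist y z / 2 ^ n) \<and>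
         (\<forall>y\<in>cball a 1. (fstep f ^^ m) (Some (exp (g y))) = Some (exp y))"
  shows "exp x \<in> julia_set f"
proof (rule ccontr)
  assume "\<not> ?thesis"
  then obtain U where U: "open U" "exp x \<in> U" "\<And>n w. w \<in> U \<Longrightarrow> (fstep f ^^ n) (Some w) \<noteq> None"
    and normal: "normal_family_chordal U (range (iter f))"
    by (auto simp: julia_set_def fatou_set_def)
  obtain g m where gx: "\<And>n. x \<in> g n ` cball a 1"
    and g: "\<And>n y z. y \<in> cball a 1 \<Longrightarrow> z \<in> cball a 1 \<Longrightarrow> dist (g n y) (g n z) \<le> dist y z / 2 ^ n"
    and m: "\<And>n y. y \<in> cball a 1 \<Longrightarrow> (fstep f ^^ m n) (Some (exp (g n y))) = Some (exp y)"
    using shrink by metis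
  obtain \<rho> where \<rho>: "\<rho> > 0" "cball (exp x) \<rho> \<subseteq> U" using U(1,2) open_contains_cball by blast
  obtain r h where r: "strict_mono (r :: nat \<Rightarrow> nat)"
    and lim: "\<And>K. compact K \<Longrightarrow> K \<subseteq> U \<Longrightarrow> uniform_limit K (\<lambda>k z. stereo (iter f (m (r k)) z)) h sequentially"
    using normal[unfolded normal_family_chordal_def, rule_format, of "\<lambda>k. iter f (m k)"] by auto
  define K where "K = cball (exp x) \<rho>"
  have limK: "uniform_limit K (\<lambda>k z. stereo (iter f (m (r k)) z)) h sequentially"
    by (rule lim) (use \<rho> in \<open>auto simp: K_def\<close>)
  have cont: "continuous_on K h"
  proof (rule uniform_limit_theorem[OF _ limK])
    show "\<forall>\<^sub>F k in sequentially. continuous_on K (\<lambda>z. stereo (iter f (m (r k)) z))"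
    proof (rule always_eventually, rule allI)
      fix k
      have "continuous_on K (iter f (m (r k)))"
        by (rule continuous_on_subset[OF continuous_on_iter[OF f U(3)]]) (use \<rho> in \<open>auto simp: K_def\<close>)
      from continuous_on_compose[OF this continuous_on_stereo]
      show "continuous_on K (\<lambda>z. stereo (iter f (m (r k)) z))" by (simp add: o_def)
    qed
  qed simp
  \<comment> \<open>For every \<open>p\<close> the points \<open>exp (g n p)\<close> tend to
    \<open>exp x\<close>, while the \<open>m n\<close>-th iterate sends them to
    \<open>exp p\<close>. Uniform convergence and continuity of \<open>h\<close> force all these
    values to coincide on the sphere.\<close>
  have val: "stereo (exp p) = h (exp x)" if p: "p \<in> cball a 1" for p
  proof -
    have "dist (g n p) x \<le> 2 / 2 ^ n" for n
    proof -
      obtain y where y: "y \<in> cball a 1" "x = g n y" using gx[of n] by blast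
      have "dist p y \<le> 2" using p y dist_triangle[of p y a] by (auto simp: dist_commute)
      have "dist (g n p) x \<le> dist p y / 2 ^ n" using g[OF p y(1), of n] y(2) by simp
      also have "\<dots> \<le> 2 / 2 ^ n" using \<open>dist p y \<le> 2\<close> by (intro divide_right_mono) auto
      finally show ?thesis .
    qed
    moreover have "(\<lambda>n. 2 / 2 ^ n :: real) \<longlonglongrightarrow> 0" by real_asymp
    ultimately have "(\<lambda>n. g n p) \<longlonglongrightarrow> x" by (rule_tac metric_tendsto_imp_tendsto[OF _ always_eventually]) auto
    hence "(\<lambda>n. exp (g n p)) \<longlonglongrightarrow> exp x" by (intro tendsto_intros)
    hence ex: "(\<lambda>k. exp (g (r k) p)) \<longlonglongrightarrow> exp x" using LIMSEQ_subseq_LIMSEQ[OF _ r] by (auto simp: o_def)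
    have evK: "\<forall>\<^sub>F k in sequentially. exp (g (r k) p) \<in> K"
      using tendstoD[OF ex \<rho>(1)] by eventually_elim (auto simp: K_def dist_commute)
    have hl: "(\<lambda>k. h (exp (g (r k) p))) \<longlonglongrightarrow> h (exp x)"
      using continuous_on_tendsto_compose[OF cont ex _ evK] \<rho> by (simp add: K_def)
    have "(\<lambda>k. h (exp (g (r k) p))) \<longlonglongrightarrow> stereo (exp p)"
    proof (rule tendstoI)
      fix e :: real assume "e > 0"
      from uniform_limitD[OF limK this] evK
      show "\<forall>\<^sub>F k in sequentially. dist (h (exp (g (r k) p))) (stereo (exp p)) < e"
      proof eventually_elim
        case (elim k)
        hence "dist (stereo (iter f (m (r k)) (exp (g (r k) p)))) (h (exp (g (r k) p))) < e" by blast
        moreover have "iter f (m (r k)) (exp (g (r k) p)) = exp p" using m[OF p] by (simp add: iter_def)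
        ultimately show ?case by (simp add: dist_commute)
      qed
    qed
    thus ?thesis using LIMSEQ_unique[OF hl] by simp
  qed
  \<comment> \<open>Two points of the disc whose exponentials have different moduli suffice, as
    \<open>stereo\<close> determines the modulus.\<close>
  have "a + 1 \<in> cball a 1" "a \<in> cball a 1" by (auto simp: dist_norm)
  hence "stereo (exp (a + 1)) = stereo (exp a)" using val by metis
  thus False using stereo_eq_imp_cmod_eq[of "exp (a + 1)" "exp a"] by simp
qed

text \<open>All branches return to one disc, so they form an iterated function system there. The
  covering bound applies to its limit set in the logarithmic coordinate, and \<open>exp\<close>
  carries it into the Julia set.\<close>

lemma hausdorff_dim_julia_ge:
  assumes f: "f nicely_meromorphic_on UNIV" and \<Phi>: "branch_system f n a \<Phi>" and tgt: "\<And>\<phi>. \<phi> \<in> \<Phi> \<Longrightarrow> target \<phi> = a"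
    and t: "t > 0" and w: "1 \<le> weight t \<Phi>"
  shows "t \<le> hausdorff_dim (julia_set f)"
proof -
  define Q where "Q = cball a 1"
  note D = branch_systemD[OF \<Phi>, folded Q_def]
  have fin: "finite \<Phi>" by (rule branch_system_finite[OF \<Phi>])
  have maps: "fst \<phi> ` Q \<subseteq> Q" if "\<phi> \<in> \<Phi>" for \<phi> using D(3)[OF that] tgt[OF that] by (simp add: Q_def)
  \<comment> \<open>A single branch has weight at most \<open>(1/2) powr t\<close>, which is below
    1.\<close>
  have card: "2 \<le> card \<Phi>"
  proof (rule ccontr)
    assume "\<not> 2 \<le> card \<Phi>"
    hence "card \<Phi> = 0 \<or> card \<Phi> = 1" by linarith
    hence "\<Phi> = {} \<or> (\<exists>\<phi>. \<Phi> = {\<phi>})" using fin by (auto simp: card_1_singleton_iff)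
    then consider "\<Phi> = {}" | \<phi> where "\<Phi> = {\<phi>}" by blast
    thus False
    proof cases
      case 1
      thus False using w by (simp add: weight_def)
    next
      case 2
      hence "ratio \<phi> powr t \<le> (1/2) powr t" using D(1,2)[of \<phi>] t by (intro powr_mono2) auto
      also have "\<dots> < 1 powr t" using t by (intro powr_less_mono2) auto
      finally show False using w 2 by (simp add: weight_def)
    qed
  qed
  have cont: "continuous_on A (fst \<phi>)" if "\<phi> \<in> \<Phi>" "A \<subseteq> Q" for \<phi> A
  proof (rule continuous_on_subset[OF _ that(2)], rule lipschitz_on_continuous_on)
    show "1-lipschitz_on Q (fst \<phi>)"
    proof (rule lipschitz_onI)
      fix x y assume "x \<in> Q" "y \<in> Q"
      from D(5)[OF that(1) this] show "dist (fst \<phi> x) (fst \<phi> y) \<le> 1 * dist x y"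
        using zero_le_dist[of x y] by linarith
    qed simp
  qed
  define E where "E = rec_nat Q (\<lambda>_ A. \<Union>\<phi>\<in>\<Phi>. fst \<phi> ` A)"
  have E0: "E 0 = Q" and ES: "\<And>k. E (Suc k) = (\<Union>\<phi>\<in>\<Phi>. fst \<phi> ` E k)" by (simp_all add: E_def)
  have Edec: "E (Suc k) \<subseteq> E k" for k
  proof (induction k)
    case 0
    show ?case using maps unfolding ES E0 by blast
  next
    case (Suc k)
    thus ?case unfolding ES[of "Suc k"] ES[of k] by blast
  qed
  have EQ: "E k \<subseteq> Q" for k
    by (induction k) (use Edec E0 in auto)
  have Ecpt: "compact (E k)" for k
  proof (induction k)
    case 0
    thus ?case by (simp add: E0 Q_def)
  next
    case (Suc k)
    thus ?case unfolding ES using fin cont EQ by (intro compact_UN compact_continuous_image) auto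
  qed
  have "\<Phi> \<noteq> {}" using card by auto
  hence Ene: "E k \<noteq> {}" for k
    by (induction k) (simp add: E0 Q_def, unfold ES, blast)
  define X where "X = (\<Inter>k. E k)"
  have Xne: "X \<noteq> {}" unfolding X_def
  proof (rule compact_nest[OF Ecpt Ene])
    show "E l \<subseteq> E k" if "k \<le> l" for k l by (rule lift_Suc_antimono_le[of E, OF Edec that])
  qed
  have Xcpt: "compact X" unfolding X_def using Ecpt by (intro compact_Inter) auto
  have XQ: "X \<subseteq> Q" using EQ[of 0] by (auto simp: X_def)
  have Xmap: "fst \<phi> ` X \<subseteq> X" if \<phi>: "\<phi> \<in> \<Phi>" for \<phi>
  proof
    fix y assume "y \<in> fst \<phi> ` X"
    then obtain x where x: "x \<in> X" "y = fst \<phi> x" by blast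
    have "y \<in> E (Suc k)" for k using x \<phi> unfolding ES X_def by blast
    moreover have "y \<in> E 0" using x \<phi> maps XQ unfolding E0 by blast
    ultimately have "y \<in> E k" for k by (cases k) auto
    thus "y \<in> X" by (simp add: X_def)
  qed
  define P where "P = {p \<in> \<Phi> \<times> \<Phi>. fst p \<noteq> snd p}"
  have "\<exists>d>0. \<forall>x\<in>Q. \<forall>y\<in>Q. d \<le> dist (fst (fst p) x) (fst (snd p) y)"
    if p: "p \<in> P" for p
  proof -
    have pp: "fst p \<in> \<Phi>" "snd p \<in> \<Phi>" "fst p \<noteq> snd p" using p by (auto simp: P_def)
    have "compact (fst (fst p) ` Q)" "closed (fst (snd p) ` Q)"
      using cont[OF pp(1) order_refl] cont[OF pp(2) order_refl]
      by (auto intro!: compact_continuous_image compact_imp_closed simp: Q_def)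
    moreover have "fst (fst p) ` Q \<inter> fst (snd p) ` Q = {}"
      using branch_system_inj[OF \<Phi> pp(1,2)] pp(3) by (force simp: Q_def)
    ultimately obtain d where "d > 0" "\<forall>x\<in>fst (fst p) ` Q. \<forall>y\<in>fst (snd p) ` Q. d \<le> dist x y"
      using separate_compact_closed by metis
    thus ?thesis by auto
  qed
  hence "\<forall>p\<in>P. \<exists>d. 0 < d \<and> (\<forall>x\<in>Q. \<forall>y\<in>Q. d \<le> dist (fst (fst p) x) (fst (snd p) y))" by blast
  from bchoice[OF this] obtain d
    where d: "\<forall>p\<in>P. 0 < d p \<and> (\<forall>x\<in>Q. \<forall>y\<in>Q. d p \<le> dist (fst (fst p) x) (fst (snd p) y))" ..
  \<comment> \<open>Images of the closed disc under different branches are disjoint compact sets,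
    already after \<open>exp\<close>; the 1 guarantees that the minimum is over a nonempty
    set.\<close>
  define \<delta> where "\<delta> = Min (insert 1 (d ` P))"
  have dfin: "finite (insert 1 (d ` P))" using fin by (auto simp: P_def)
  have \<delta>: "\<delta> > 0" unfolding \<delta>_def using dfin d by (subst Min_gr_iff) auto
  have sep: "\<delta> \<le> dist (fst \<phi> x) (fst \<psi> y)" if "\<phi> \<in> \<Phi>" "\<psi> \<in> \<Phi>" "\<phi> \<noteq> \<psi>" "x \<in> X" "y \<in> X" for \<phi> \<psi> x y
  proof -
    have "\<delta> \<le> d (\<phi>, \<psi>)" unfolding \<delta>_def using that by (intro Min_le dfin) (auto simp: P_def)
    also have "\<dots> \<le> dist (fst \<phi> x) (fst \<psi> y)" using d[rule_format, of "(\<phi>, \<psi>)"] that XQ by (auto simp: P_def)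
    finally show ?thesis .
  qed
  \<comment> \<open>A point of level \<open>k\<close> lies in the image of a composition of
    \<open>k\<close> branches. Each contracts by 1/2, and \<open>m\<close> adds up the
    \<open>n\<close> steps of \<open>f\<close> per branch.\<close>
  have words: "\<exists>g m. x \<in> g ` Q \<and> g ` Q \<subseteq> Q \<and> (\<forall>y\<in>Q. \<forall>z\<in>Q. dist (g y) (g z) \<le> dist y z / 2 ^ k) \<and>
         (\<forall>y\<in>Q. (fstep f ^^ m) (Some (exp (g y))) = Some (exp y))" if "x \<in> E k" for x k
    using that
  proof (induction k arbitrary: x)
    case 0
    thus ?case by (intro exI[of _ "\<lambda>x. x"] exI[of _ 0]) (auto simp: E0)
  next
    case (Suc k)
    then obtain \<phi> y where \<phi>: "\<phi> \<in> \<Phi>" "y \<in> E k" "x = fst \<phi> y" by (auto simp: ES)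
    from Suc.IH[OF \<phi>(2)] obtain g m where g: "y \<in> g ` Q" "g ` Q \<subseteq> Q"
      "\<And>u z. u \<in> Q \<Longrightarrow> z \<in> Q \<Longrightarrow> dist (g u) (g z) \<le> dist u z / 2 ^ k"
      "\<And>u. u \<in> Q \<Longrightarrow> (fstep f ^^ m) (Some (exp (g u))) = Some (exp u)" by blast
    have gQ: "g u \<in> Q" if "u \<in> Q" for u using g(2) that by blast
    have "dist (fst \<phi> (g u)) (fst \<phi> (g z)) \<le> dist u z / 2 ^ Suc k" if "u \<in> Q" "z \<in> Q" for u z
      using D(5)[OF \<phi>(1) gQ[OF that(1)] gQ[OF that(2)]] g(3)[OF that] by simp
    moreover have "(fstep f ^^ (m + n)) (Some (exp (fst \<phi> (g u)))) = Some (exp u)" if "u \<in> Q" for u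
      using D(6)[OF \<phi>(1) gQ[OF that]] g(4)[OF that] by (simp add: funpow_add)
    moreover have "x \<in> (\<lambda>u. fst \<phi> (g u)) ` Q" using g(1) \<phi>(3) by blast
    moreover have "(\<lambda>u. fst \<phi> (g u)) ` Q \<subseteq> Q" using gQ maps[OF \<phi>(1)] by blast
    ultimately show ?case by (intro exI[of _ "\<lambda>u. fst \<phi> (g u)"] exI[of _ "m + n"]) blast
  qed
  have julia: "exp ` X \<subseteq> julia_set f"
  proof
    fix y assume "y \<in> exp ` X"
    then obtain x where x: "x \<in> X" "y = exp x" by blast
    have "exp x \<in> julia_set f"
    proof (rule in_julia_setI[OF f])
      fix k
      have "x \<in> E k" using x(1) by (simp add: X_def)
      from words[OF this] show "\<exists>g m. x \<in> g ` cball a 1 \<and>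
         (\<forall>y\<in>cball a 1. \<forall>z\<in>cball a 1. dist (g y) (g z) \<le> dist y z / 2 ^ k) \<and>
         (\<forall>y\<in>cball a 1. (fstep f ^^ m) (Some (exp (g y))) = Some (exp y))"
        unfolding Q_def by blast
    qed
    thus "y \<in> julia_set f" using x by simp
  qed
  obtain \<kappa> where \<kappa>: "\<kappa> > 0" "\<And>x y. x \<in> Q \<Longrightarrow> y \<in> Q \<Longrightarrow> dist x y \<le> \<kappa> * dist (exp x) (exp y)"
    using exp_expands_on_cball[of a] unfolding Q_def by metis
  show ?thesis
  proof (rule hausdorff_dim_ge[OF Xcpt t _ \<kappa>(1) _ julia])
    show "0 < \<delta> powr t" using \<delta> by simp
    show "dist x y \<le> \<kappa> * dist (exp x) (exp y)" if "x \<in> X" "y \<in> X" for x y using \<kappa>(2) that XQ by blast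
    fix N :: "nat set" and C :: "nat \<Rightarrow> complex set"
    assume N: "finite N" "X \<subseteq> (\<Union>n\<in>N. C n)" "\<And>n. n \<in> N \<Longrightarrow> bounded (C n)"
    show "\<delta> powr t \<le> (\<Sum>n\<in>N. diameter (C n) powr t)"
    proof (rule finite_cover_sum_ge[OF fin card Xne _ sep \<delta> t _ N])
      show "0 < ratio \<phi> \<and> fst \<phi> ` X \<subseteq> X \<and> (\<forall>x\<in>X. \<forall>y\<in>X. ratio \<phi> * dist x y \<le> dist (fst \<phi> x) (fst \<phi> y))"
        if "\<phi> \<in> \<Phi>" for \<phi>
        using D(1)[OF that] D(4)[OF that] Xmap[OF that] XQ by blast
      show "1 \<le> (\<Sum>\<phi>\<in>\<Phi>. ratio \<phi> powr t)" using w by (simp add: weight_def)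
    qed
  qed
qed

section \<open>Branches inside a logarithmic tract\<close>

text \<open>These points lie in one fibre of \<open>exp\<close>, so
  \<open>exp (G (shift c k))\<close> runs through preimages of \<open>exp c\<close> under
  \<open>f\<close>.\<close>

definition shift :: "complex \<Rightarrow> nat \<Rightarrow> complex" where
  "shift c k = c + of_real (2 * pi * real k) * \<i>"

text \<open>Along the points \<open>shift c k\<close> the real part of \<open>G\<close> climbs from below \<open>L\<close> to above \<open>2 * L\<close>, with
  steps bounded by multiples of the derivative of \<open>G\<close>; this makes the sum of the derivatives large.\<close>
lemma tract_branches:
  assumes h0: "h0 \<ge> 0" and hol: "G holomorphic_on {z. h0 < Re z}"
    and inj: "\<And>x y. h0 < Re x \<Longrightarrow> h0 < Re y \<Longrightarrow> exp (G x) = exp (G y) \<Longrightarrow> x = y"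
    and lim: "\<And>c. h0 < Re c \<Longrightarrow> filterlim (\<lambda>n. Re (G (shift c n))) at_top sequentially"
  obtains L where "L > h0 + 1" "L > 0"
    "\<And>c. L \<le> Re c \<Longrightarrow> Re c \<le> 2 * L \<Longrightarrow> 0 \<le> Im c \<Longrightarrow> Im c \<le> 2 * pi \<Longrightarrow>
       \<exists>I :: nat set. finite I \<and> 6 \<le> (\<Sum>k\<in>I. cmod (deriv G (shift c k))) \<and>
         (\<forall>k\<in>I. L \<le> Re (G (shift c k)) \<and> Re (G (shift c k)) \<le> 2 * L)"
    "\<And>w. L \<le> Re w \<Longrightarrow> 0 < cmod (deriv G w) \<and> cmod (deriv G w) \<le> 1/4 \<and>
       (\<forall>x\<in>cball w 1. \<forall>y\<in>cball w 1. 3/4 * cmod (deriv G w) * dist x y \<le> dist (G x) (G y) \<and>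
          dist (G x) (G y) \<le> dist x y / 2)"
proof -
  define H where "H = {z. h0 < Re z}"
  have Hopen: "open H" and Hconv: "convex H"
    unfolding H_def by (rule open_halfspace_Re_gt, rule convex_halfspace_Re_gt)
  obtain K where K: "K > 0" and near: "\<And>(g::complex \<Rightarrow> complex) a R s x y. g holomorphic_on ball a R \<Longrightarrow> inj_on g (ball a R) \<Longrightarrow> 0 < s \<Longrightarrow> K * s \<le> R \<Longrightarrow>
     x \<in> cball a s \<Longrightarrow> y \<in> cball a s \<Longrightarrow> cmod (g x - g y - deriv g a * (x - y)) \<le> cmod (deriv g a) * cmod (x - y) / 4"
    using univalent_near_linear by metis
  have ballH: "ball w R \<subseteq> H" if "R \<le> Re w - h0" for w R
  proof
    fix z assume "z \<in> ball w R"
    hence "\<bar>Re (w - z)\<bar> < R" using abs_Re_le_cmod[of "w - z"] by (auto simp: dist_norm)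
    thus "z \<in> H" using that by (auto simp: H_def)
  qed
  have Ginj: "inj_on G H" by (rule inj_onI) (use inj in \<open>auto simp: H_def\<close>)
  have dG: "(Re w - h0) * cmod (deriv G w) \<le> 48" if "w \<in> H" for w
  proof (rule exp_inj_deriv_bound)
    show "G holomorphic_on ball w (Re w - h0)"
      using holomorphic_on_subset[OF hol, folded H_def, OF ballH] by simp
    show "Re w - h0 > 0" using that by (simp add: H_def)
    show "x = y" if "x \<in> ball w (Re w - h0)" "y \<in> ball w (Re w - h0)" "exp (G x) = exp (G y)" for x y
    proof -
      have "x \<in> H" "y \<in> H" using that(1,2) ballH[of "Re w - h0" w] by auto
      thus ?thesis using inj that(3) by (simp add: H_def)
    qed
  qed
  \<comment> \<open>To the right of \<open>x1\<close> Bloch's bound gives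
    \<open>cmod (deriv G w) \<le> 48 / 768 = 1/16\<close>.\<close>
  define x1 where "x1 = h0 + 768"
  \<comment> \<open>The term \<open>8 * K\<close> makes \<open>G\<close> nearly linear on discs of
    radius 8, which contain a step of length \<open>2 \<pi>\<close>. The last term keeps the start
    of each climb below \<open>L\<close>, and 70 makes the final sum at least 6.\<close>
  define L where "L = max (h0 + 8 * K) (max x1 (2 * cmod (G (of_real x1)) + 70))"
  have L1: "h0 + 8 * K \<le> L" and L2: "x1 \<le> L" and L3: "2 * cmod (G (of_real x1)) + 70 \<le> L"
    by (auto simp: L_def)
  have L70: "L \<ge> 70" using L3 norm_ge_zero[of "G (of_real x1)"] by linarith
  have Lh: "L > h0" using L2 by (simp add: x1_def)
  have H: "w \<in> H" if "L \<le> Re w" for w using that Lh by (simp add: H_def)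
  have small: "cmod (deriv G w) \<le> 1/16" if "x1 \<le> Re w" for w
  proof -
    have "768 * cmod (deriv G w) \<le> (Re w - h0) * cmod (deriv G w)"
      using that by (intro mult_right_mono) (auto simp: x1_def)
    also have "\<dots> \<le> 48" using that by (intro dG) (auto simp: x1_def H_def)
    finally show ?thesis by simp
  qed
  have lin: "cmod (G x - G y - deriv G w * (x - y)) \<le> cmod (deriv G w) * cmod (x - y) / 4"
    if w: "L \<le> Re w" and xy: "x \<in> cball w 8" "y \<in> cball w 8" for w x y
  proof (rule near[OF _ _ _ _ xy])
    show "G holomorphic_on ball w (Re w - h0)"
      using holomorphic_on_subset[OF hol, folded H_def, OF ballH] by simp
    show "inj_on G (ball w (Re w - h0))" by (rule inj_on_subset[OF Ginj ballH]) simp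
    show "K * 8 \<le> Re w - h0" using w L1 by simp
  qed simp
  have upper: "cmod (G x - G y) \<le> 5/4 * cmod (deriv G w) * cmod (x - y)"
    if "L \<le> Re w" "x \<in> cball w 8" "y \<in> cball w 8" for w x y
    using lin[OF that] norm_triangle_ineq2[of "G x - G y" "deriv G w * (x - y)"] by (simp add: norm_mult)
  have lower: "3/4 * cmod (deriv G w) * cmod (x - y) \<le> cmod (G x - G y)"
    if "L \<le> Re w" "x \<in> cball w 8" "y \<in> cball w 8" for w x y
    using lin[OF that] norm_triangle_ineq2[of "deriv G w * (x - y)" "G x - G y"] by (simp add: norm_mult norm_minus_commute)
  \<comment> \<open>With slope at most 1/16 over a distance of at most \<open>2 * L + 8\<close>,
    \<open>G\<close> changes by at most \<open>L/8 + 1/2\<close>; its size at \<open>x1\<close> is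
    at most \<open>L/2 - 35\<close>.\<close>
  have base: "Re (G c) \<le> L" if c: "L \<le> Re c" "Re c \<le> 2 * L" "0 \<le> Im c" "Im c \<le> 2 * pi" for c
  proof -
    have "cmod (G c - G (of_real x1)) \<le> 1/16 * cmod (c - of_real x1)"
    proof (rule field_differentiable_bound[of "{z. x1 \<le> Re z}" G "deriv G"])
      show "convex {z. x1 \<le> Re z}" by (rule convex_halfspace_Re_ge)
      show "(G has_field_derivative deriv G z) (at z within {z. x1 \<le> Re z})" if "z \<in> {z. x1 \<le> Re z}" for z
        by (rule has_field_derivative_at_within, rule holomorphic_derivI[OF hol[folded H_def] Hopen])
           (use that in \<open>auto simp: H_def x1_def\<close>)
    qed (use small c L2 in auto)
    moreover have "cmod (c - of_real x1) \<le> 2 * L + 8"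
    proof -
      have "x1 > 0" using h0 by (simp add: x1_def)
      moreover have "pi < 4" by (rule pi_less_4)
      ultimately show ?thesis using cmod_le[of "c - of_real x1"] c L2 by auto
    qed
    moreover have "Re (G c) \<le> cmod (G c - G (of_real x1)) + cmod (G (of_real x1))"
      using complex_Re_le_cmod[of "G c"] norm_triangle_sub[of "G c" "G (of_real x1)"] by linarith
    ultimately show ?thesis using L3 norm_ge_zero[of "G (of_real x1)"] by linarith
  qed
  show thesis
  proof
    show "L > h0 + 1" using L2 by (simp add: x1_def)
    show "L > 0" using L70 by simp
    show "0 < cmod (deriv G w) \<and> cmod (deriv G w) \<le> 1/4 \<and>
       (\<forall>x\<in>cball w 1. \<forall>y\<in>cball w 1. 3/4 * cmod (deriv G w) * dist x y \<le> dist (G x) (G y) \<and>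
          dist (G x) (G y) \<le> dist x y / 2)" if w: "L \<le> Re w" for w
    proof (intro conjI ballI)
      have "deriv G w \<noteq> 0"
        by (rule holomorphic_injective_imp_regular[OF hol[folded H_def] Hopen Ginj H[OF w]])
      thus "0 < cmod (deriv G w)" by simp
      have sm: "cmod (deriv G w) \<le> 1/16" using small w L2 by simp
      thus "cmod (deriv G w) \<le> 1/4" by simp
      fix x y assume "x \<in> cball w 1" "y \<in> cball w 1"
      hence xy: "x \<in> cball w 8" "y \<in> cball w 8" by auto
      show "3/4 * cmod (deriv G w) * dist x y \<le> dist (G x) (G y)"
        using lower[OF w xy] by (simp add: dist_norm)
      have "5/4 * cmod (deriv G w) * cmod (x - y) \<le> 1/2 * cmod (x - y)" using sm by (intro mult_right_mono) auto
      thus "dist (G x) (G y) \<le> dist x y / 2" using upper[OF w xy] by (simp add: dist_norm)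
    qed
    fix c assume c: "L \<le> Re c" "Re c \<le> 2 * L" "0 \<le> Im c" "Im c \<le> 2 * pi"
    define w where "w = shift c"
    define a where "a = (\<lambda>k. Re (G (w k)))"
    have wRe: "Re (w k) = Re c" for k by (simp add: w_def shift_def)
    have a0: "a 0 \<le> L" using base[OF c] by (simp add: a_def w_def shift_def)
    have step: "a (Suc k) - a k \<le> 10 * cmod (deriv G (w k))" for k
    proof -
      have ww: "w (Suc k) - w k = of_real (2 * pi) * \<i>" by (simp add: w_def shift_def algebra_simps)
      have nw: "cmod (w (Suc k) - w k) = 2 * pi" unfolding ww by (simp add: norm_mult)
      have p4: "pi < 4" by (rule pi_less_4)
      have "a (Suc k) - a k \<le> cmod (G (w (Suc k)) - G (w k))"
        using complex_Re_le_cmod[of "G (w (Suc k)) - G (w k)"] by (simp add: a_def)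
      also have "\<dots> \<le> 5/4 * cmod (deriv G (w k)) * cmod (w (Suc k) - w k)"
        by (rule upper) (use c wRe nw p4 in \<open>auto simp: dist_norm norm_minus_commute\<close>)
      also have "\<dots> \<le> 5/4 * cmod (deriv G (w k)) * 8" unfolding nw using p4 by (intro mult_left_mono) auto
      finally show ?thesis by simp
    qed
    have "filterlim a at_top sequentially"
      unfolding a_def w_def by (rule lim) (use c Lh in auto)
    hence "\<exists>n. 2 * L < a n"
      using filterlim_at_top_dense[of a sequentially] eventually_happens[of "\<lambda>n. 2 * L < a n" sequentially] by auto
    \<comment> \<open>The climb is cut at the first index \<open>n\<close> above
      \<open>2 * L\<close> and the last earlier index \<open>m\<close> not above \<open>L\<close>;
      strictly between them all values lie in the strip.\<close>
    define n where "n = (LEAST n. 2 * L < a n)"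
    have n: "2 * L < a n" unfolding n_def by (rule LeastI_ex) fact
    have nmin: "a k \<le> 2 * L" if "k < n" for k using not_less_Least[OF that[unfolded n_def]] by simp
    define m where "m = Max {k \<in> {..n}. a k \<le> L}"
    have mset: "finite {k \<in> {..n}. a k \<le> L}" "{k \<in> {..n}. a k \<le> L} \<noteq> {}" using a0 by auto
    have m: "m \<le> n" "a m \<le> L" using Max_in[OF mset] by (auto simp: m_def)
    have mmax: "L < a k" if "m < k" "k \<le> n" for k
    proof (rule ccontr)
      assume "\<not> L < a k"
      hence "k \<in> {k \<in> {..n}. a k \<le> L}" using that by auto
      hence "k \<le> m" unfolding m_def using mset by (intro Max_ge) auto
      thus False using that by simp
    qed
    have mn: "m < n" using m n L70 by (cases "m = n") auto
    \<comment> \<open>Index \<open>m\<close> is left out because its image may lie left of the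
      strip. The lost increment is at most 10/16, negligible against \<open>L\<close>.\<close>
    define I where "I = {Suc m..<n}"
    have "L < a n - a m" using n m by linarith
    also have "a n - a m = (\<Sum>k\<in>{m..<n}. a (Suc k) - a k)" using sum_Suc_diff'[of m n a] mn by simp
    also have "\<dots> = (a (Suc m) - a m) + (\<Sum>k\<in>I. a (Suc k) - a k)"
      unfolding I_def using mn by (rule sum.atLeast_Suc_lessThan)
    also have "\<dots> \<le> 10 * cmod (deriv G (w m)) + (\<Sum>k\<in>I. 10 * cmod (deriv G (w k)))"
      using step by (intro add_mono sum_mono) auto
    also have "\<dots> \<le> 10 * (1/16) + 10 * (\<Sum>k\<in>I. cmod (deriv G (w k)))"
      using small[of "w m"] c L2 wRe by (simp add: sum_distrib_left)
    finally have "6 \<le> (\<Sum>k\<in>I. cmod (deriv G (w k)))" using L70 by simp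
    moreover have "\<forall>k\<in>I. L \<le> Re (G (w k)) \<and> Re (G (w k)) \<le> 2 * L"
      using mmax nmin by (auto simp: I_def a_def intro: less_imp_le)
    moreover have "finite I" by (simp add: I_def)
    ultimately show "\<exists>I :: nat set. finite I \<and> 6 \<le> (\<Sum>k\<in>I. cmod (deriv G (shift c k))) \<and>
         (\<forall>k\<in>I. L \<le> Re (G (shift c k)) \<and> Re (G (shift c k)) \<le> 2 * L)"
      unfolding w_def by blast
  qed
qed

text \<open>The ratios at each centre are 3/4 of the derivatives, so at exponent 1 they sum to at
  least 9/2. Raising the exponent by \<open>\<eta>\<close> costs at most a factor 2, and 9/4 still
  exceeds 2.\<close>

lemma hausdorff_dim_julia_gt_1:
  assumes f: "f nicely_meromorphic_on UNIV" and h0: "h0 \<ge> 0" and hol: "G holomorphic_on {z. h0 < Re z}"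
    and inj: "\<And>x y. h0 < Re x \<Longrightarrow> h0 < Re y \<Longrightarrow> exp (G x) = exp (G y) \<Longrightarrow> x = y"
    and lim: "\<And>c. h0 < Re c \<Longrightarrow> filterlim (\<lambda>n. Re (G (shift c n))) at_top sequentially"
    and fG: "\<And>z. h0 < Re z \<Longrightarrow> \<not> is_pole f (exp (G z)) \<and> f (exp (G z)) = exp z"
  shows "1 < hausdorff_dim (julia_set f)"
proof -
  obtain L where L: "L > h0 + 1" "L > 0"
    and branches: "\<And>c. L \<le> Re c \<Longrightarrow> Re c \<le> 2 * L \<Longrightarrow> 0 \<le> Im c \<Longrightarrow> Im c \<le> 2 * pi \<Longrightarrow>
       \<exists>I :: nat set. finite I \<and> 6 \<le> (\<Sum>k\<in>I. cmod (deriv G (shift c k))) \<and>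
         (\<forall>k\<in>I. L \<le> Re (G (shift c k)) \<and> Re (G (shift c k)) \<le> 2 * L)"
    and lip: "\<And>w. L \<le> Re w \<Longrightarrow> 0 < cmod (deriv G w) \<and> cmod (deriv G w) \<le> 1/4 \<and>
       (\<forall>x\<in>cball w 1. \<forall>y\<in>cball w 1. 3/4 * cmod (deriv G w) * dist x y \<le> dist (G x) (G y) \<and>
          dist (G x) (G y) \<le> dist x y / 2)"
  proof (rule tract_branches[OF h0 hol], goal_cases)
    case (1 x y)
    show ?case by (rule inj[OF 1(2-4)])
  next
    case (2 c)
    show ?case by (rule lim[OF 2(2)])
  next
    case (3 L)
    show ?case by (rule 3(1)[OF 3(2-5)])
  qed
  define S where "S = cbox (Complex L 0) (Complex (2 * L) (2 * pi))"
  have S: "z \<in> S \<longleftrightarrow> L \<le> Re z \<and> Re z \<le> 2 * L \<and> 0 \<le> Im z \<and> Im z \<le> 2 * pi" for z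
    by (auto simp: S_def in_cbox_complex_iff)
  have "compact S" "S \<subseteq> (\<Union>v\<in>S. ball v (1/2))" by (auto simp: S_def)
  \<comment> \<open>Radius 1/2 fits the contraction: a branch maps a unit disc to within 1/2 of the
    image of its centre, which in turn lies within 1/2 of a point of \<open>V\<close>.\<close>
  then obtain V where V: "V \<subseteq> S" "finite V" "S \<subseteq> (\<Union>v\<in>V. ball v (1/2))"
    using compactE_image[of S S "\<lambda>v. ball v (1/2)"] by (metis open_ball)
  have "Complex L 0 \<in> S" using L by (simp add: S)
  hence Vne: "V \<noteq> {}" using V(3) by auto
  have "\<exists>v\<in>V. p \<in> ball v (1/2)" if "p \<in> S" for p using V(3) that by blast
  then obtain near where near: "\<And>p. p \<in> S \<Longrightarrow> near p \<in> V" "\<And>p. p \<in> S \<Longrightarrow> p \<in> ball (near p) (1/2)" by metis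
  have "\<exists>I :: nat set. finite I \<and> 6 \<le> (\<Sum>k\<in>I. cmod (deriv G (shift c k))) \<and>
         (\<forall>k\<in>I. L \<le> Re (G (shift c k)) \<and> Re (G (shift c k)) \<le> 2 * L)" if "c \<in> V" for c
    using that V(1) S by (intro branches) auto
  then obtain I :: "complex \<Rightarrow> nat set" where I: "\<And>c. c \<in> V \<Longrightarrow> finite (I c)" "\<And>c. c \<in> V \<Longrightarrow> 6 \<le> (\<Sum>k\<in>I c. cmod (deriv G (shift c k)))"
    "\<And>c k. c \<in> V \<Longrightarrow> k \<in> I c \<Longrightarrow> L \<le> Re (G (shift c k)) \<and> Re (G (shift c k)) \<le> 2 * L" by metis
  \<comment> \<open>Subtracting \<open>q\<close> periods moves the image of the centre into the
    rectangle \<open>S\<close> without changing its exponential.\<close>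
  define q where "q = (\<lambda>c k. \<lfloor>Im (G (shift c k)) / (2 * pi)\<rfloor>)"
  define T where "T = (\<lambda>c k x. G (shift x k) - of_real (2 * pi * of_int (q c k)) * \<i>)"
  define b where "b = (\<lambda>c k. 3/4 * cmod (deriv G (shift c k)))"
  define B where "B = (\<lambda>c. (\<lambda>k. (T c k, b c k, near (T c k c))) ` I c)"
  have VL: "L \<le> Re c" if "c \<in> V" for c using that V(1) S by auto
  have b: "0 < b c k" "b c k \<le> 1/4" if "c \<in> V" for c k
    using lip[of "shift c k"] VL[OF that] by (auto simp: b_def shift_def)
  have expT: "exp (T c k x) = exp (G (shift x k))" for c k x
  proof -
    have "exp (of_real (2 * pi * of_int (q c k)) * \<i>) = 1"
      by (subst exp_eq_1) (auto intro!: exI[of _ "q c k"])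
    thus ?thesis by (simp add: T_def exp_diff)
  qed
  have expsh: "exp (shift x k) = exp x" for x k
  proof -
    have "exp (of_real (2 * pi * real k) * \<i>) = 1"
      by (subst exp_eq_1) (auto intro!: exI[of _ "int k"])
    thus ?thesis by (simp add: shift_def exp_add)
  qed
  have TS: "T c k c \<in> S" if "c \<in> V" "k \<in> I c" for c k
  proof -
    define y where "y = Im (G (shift c k))"
    have "of_int (q c k) \<le> y / (2 * pi)" "y / (2 * pi) < of_int (q c k) + 1"
      unfolding q_def y_def by linarith+
    hence "2 * pi * of_int (q c k) \<le> y" "y \<le> 2 * pi * of_int (q c k) + 2 * pi"
      using pi_gt_zero by (auto simp: field_simps)
    thus ?thesis using I(3)[OF that] by (simp add: S T_def y_def)
  qed
  have dT: "dist (T c k x) (T c k y) = dist (G (shift x k)) (G (shift y k))" for c k x y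
    by (simp add: T_def dist_norm)
  have dsh: "dist (shift x k) (shift y k) = dist x y" for x y k by (simp add: shift_def dist_norm)
  have h0sh: "h0 < Re (shift x k)" if "c \<in> V" "x \<in> cball c 1" for c x k
  proof -
    have "\<bar>Re (c - x)\<bar> \<le> 1" using that(2) abs_Re_le_cmod[of "c - x"] by (simp add: dist_norm)
    hence "L - 1 \<le> Re x" using VL[OF that(1)] by auto
    thus ?thesis using L(1) by (simp add: shift_def)
  qed
  have lipT: "b c k * dist x y \<le> dist (T c k x) (T c k y)" "dist (T c k x) (T c k y) \<le> dist x y / 2"
    if "c \<in> V" "x \<in> cball c 1" "y \<in> cball c 1" for c k x y
  proof -
    have "shift x k \<in> cball (shift c k) 1" "shift y k \<in> cball (shift c k) 1" using that by (auto simp: dsh)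
    moreover have "L \<le> Re (shift c k)" using VL[OF that(1)] by (simp add: shift_def)
    ultimately have "3/4 * cmod (deriv G (shift c k)) * dist (shift x k) (shift y k) \<le> dist (G (shift x k)) (G (shift y k)) \<and>
          dist (G (shift x k)) (G (shift y k)) \<le> dist (shift x k) (shift y k) / 2" using lip by blast
    thus "b c k * dist x y \<le> dist (T c k x) (T c k y)" "dist (T c k x) (T c k y) \<le> dist x y / 2"
      by (simp_all add: dT dsh b_def)
  qed
  \<comment> \<open>Injectivity of \<open>exp \<circ> G\<close> gives
    \<open>shift x k = shift y l\<close>; imaginary parts in a unit disc differ by at most 2, less
    than one period.\<close>
  have Tinj: "x = y \<and> k = l" if c: "c \<in> V" and xy: "x \<in> cball c 1" "y \<in> cball c 1"
    and eq: "exp (T c k x) = exp (T c l y)" for c k l x y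
  proof -
    have s: "shift x k = shift y l" using inj[OF h0sh[OF c xy(1)] h0sh[OF c xy(2)]] eq by (simp add: expT)
    have "\<bar>Im (x - y)\<bar> \<le> 2"
      using abs_Im_le_cmod[of "x - y"] xy dist_triangle[of x y c] by (auto simp: dist_norm norm_minus_commute)
    moreover have "Im (x - y) = 2 * pi * (real l - real k)"
      using arg_cong[OF s, of Im] by (simp add: shift_def algebra_simps)
    ultimately have "2 * pi * \<bar>real l - real k\<bar> \<le> 2" by (simp add: abs_mult)
    have "k = l"
    proof (rule ccontr)
      assume "k \<noteq> l"
      hence "1 \<le> \<bar>real l - real k\<bar>" by linarith
      hence "2 * pi * 1 \<le> 2 * pi * \<bar>real l - real k\<bar>" by (intro mult_left_mono) auto
      thus False using \<open>2 * pi * \<bar>real l - real k\<bar> \<le> 2\<close> pi_gt3 by linarith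
    qed
    thus ?thesis using s by (simp add: shift_def)
  qed
  have system: "branch_system f 1 c (B c)" if c: "c \<in> V" for c
    unfolding branch_system_def
  proof (intro conjI ballI impI)
    show "finite (B c)" using I(1)[OF c] by (simp add: B_def)
    fix \<phi> assume "\<phi> \<in> B c"
    then obtain k where k: "k \<in> I c" "\<phi> = (T c k, b c k, near (T c k c))" by (auto simp: B_def)
    have "T c k ` cball c 1 \<subseteq> cball (near (T c k c)) 1"
    proof (rule image_subsetI)
      fix x assume x: "x \<in> cball c 1"
      have "dist (T c k c) (T c k x) \<le> 1 / 2" using lipT(2)[OF c _ x, of c k] x by auto
      moreover have "dist (near (T c k c)) (T c k c) < 1/2" using near(2)[OF TS[OF c k(1)]] by simp
      ultimately show "T c k x \<in> cball (near (T c k c)) 1"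
        using dist_triangle[of "near (T c k c)" "T c k x" "T c k c"] by simp
    qed
    moreover have "(fstep f ^^ 1) (Some (exp (T c k x))) = Some (exp x)" if "x \<in> cball c 1" for x
      using fG[OF h0sh[OF c that], of k] by (simp add: fstep_def expT expsh)
    moreover have "b c k \<le> 1/2" using b(2)[OF c, of k] by simp
    ultimately show "case \<phi> of (h, b, v) \<Rightarrow> 0 < b \<and> b \<le> 1/2 \<and> h ` cball c 1 \<subseteq> cball v 1 \<and>
        (\<forall>x\<in>cball c 1. \<forall>y\<in>cball c 1. b * dist x y \<le> dist (h x) (h y) \<and> dist (h x) (h y) \<le> dist x y / 2) \<and>
        (\<forall>x\<in>cball c 1. (fstep f ^^ 1) (Some (exp (h x))) = Some (exp x))"
      unfolding k(2) prod.case using b(1)[OF c] lipT[OF c] by blast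
  next
    fix \<phi> \<psi> x y assume "\<phi> \<in> B c" "\<psi> \<in> B c" and xy: "x \<in> cball c 1" "y \<in> cball c 1"
      and eq: "exp (fst \<phi> x) = exp (fst \<psi> y)"
    then obtain k l where "\<phi> = (T c k, b c k, near (T c k c))" "\<psi> = (T c l, b c l, near (T c l c))"
      by (auto simp: B_def)
    thus "\<phi> = \<psi>" "x = y" using Tinj[OF c xy, of k l] eq by auto
  qed
  have targets: "target \<phi> \<in> V" if "c \<in> V" "\<phi> \<in> B c" for c \<phi>
    using that near(1) TS by (auto simp: B_def)
  \<comment> \<open>Inserting 1/4 keeps \<open>\<beta>\<close> below 1, so that its logarithm is
    negative and \<open>\<eta>\<close> is the positive solution of
    \<open>\<beta> powr \<eta> = 1/2\<close>.\<close>
  define \<beta> where "\<beta> = Min (insert (1/4) ((\<lambda>(c, k). b c k) ` (SIGMA c:V. I c)))"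
  have \<beta>fin: "finite (insert (1/4) ((\<lambda>(c, k). b c k) ` (SIGMA c:V. I c)))" using V(2) I(1) by auto
  have \<beta>0: "0 < \<beta>" unfolding \<beta>_def using \<beta>fin b(1) by (subst Min_gr_iff) auto
  have \<beta>1: "\<beta> \<le> 1/4" unfolding \<beta>_def by (rule Min_le[OF \<beta>fin]) simp
  have \<beta>b: "\<beta> \<le> b c k" if "c \<in> V" "k \<in> I c" for c k unfolding \<beta>_def by (rule Min_le[OF \<beta>fin]) (use that in auto)
  define \<eta> where "\<eta> = ln (1/2) / ln \<beta>"
  have ln\<beta>: "ln \<beta> < 0" using \<beta>0 \<beta>1 by (intro ln_less_zero) auto
  have \<eta>: "\<eta> > 0" unfolding \<eta>_def by (rule divide_neg_neg[OF _ ln\<beta>]) simp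
  have \<beta>\<eta>: "\<beta> powr \<eta> = 1/2" using \<beta>0 ln\<beta> by (simp add: powr_def \<eta>_def)
  define t where "t = 1 + \<eta>"
  have heavy: "2 \<le> weight t (B c)" if c: "c \<in> V" for c
  proof -
    have "inj_on (\<lambda>k. (T c k, b c k, near (T c k c))) (I c)"
    proof (rule inj_onI)
      fix k l assume "(T c k, b c k, near (T c k c)) = (T c l, b c l, near (T c l c))"
      thus "k = l" using Tinj[OF c, of c c k l] by simp
    qed
    hence "weight t (B c) = (\<Sum>k\<in>I c. b c k powr t)"
      unfolding weight_def B_def by (subst sum.reindex) auto
    also have "\<dots> \<ge> (\<Sum>k\<in>I c. b c k * (1/2))"
    proof (rule sum_mono)
      fix k assume k: "k \<in> I c"
      have "1/2 \<le> b c k powr \<eta>" unfolding \<beta>\<eta>[symmetric] using \<beta>0 \<beta>b[OF c k] \<eta> by (intro powr_mono2) auto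
      hence "b c k * (1/2) \<le> b c k * b c k powr \<eta>" using b(1)[OF c, of k] by (intro mult_left_mono) auto
      also have "\<dots> = b c k powr t" using b(1)[OF c, of k] by (simp add: t_def powr_add)
      finally show "b c k * (1/2) \<le> b c k powr t" .
    qed
    also have "(\<Sum>k\<in>I c. b c k * (1/2)) = 3/8 * (\<Sum>k\<in>I c. cmod (deriv G (shift c k)))"
      by (simp add: b_def sum_distrib_left)
    finally show ?thesis using I(2)[OF c] by simp
  qed
  have "\<exists>n a \<Phi>. branch_system f n a \<Phi> \<and> 1 \<le> weight t \<Phi> \<and> (\<forall>\<phi>\<in>\<Phi>. target \<phi> = a)"
    by (rule branch_system_cycle[OF V(2) Vne, of f B t]; (erule system | erule (1) targets | erule heavy | blast))
  then obtain n a \<Phi> where "branch_system f n a \<Phi>" "1 \<le> weight t \<Phi>" "\<forall>\<phi>\<in>\<Phi>. target \<phi> = a" by blast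
  hence "t \<le> hausdorff_dim (julia_set f)"
    using \<eta> by (intro hausdorff_dim_julia_ge[OF f]) (auto simp: t_def)
  thus ?thesis using \<eta> by (simp add: t_def)
qed

section \<open>Logarithmic coordinates\<close>

lemma dist_stereo_north_pole: "dist (stereo w) north_pole = 2 / sqrt (1 + (cmod w)\<^sup>2)"
proof -
  define q where "q = 1 + (cmod w)\<^sup>2"
  have q: "q > 0" unfolding q_def by (intro add_pos_nonneg) auto
  have "((cmod w)\<^sup>2 - 1) / ((cmod w)\<^sup>2 + 1) - 1 = - 2 / q"
    using q by (simp add: q_def field_simps)
  hence "(dist (stereo w) north_pole)\<^sup>2 = (2 / q * cmod w)\<^sup>2 + (2 / q)\<^sup>2"
    using q by (simp add: norm_Pair stereo_def north_pole_def dist_norm norm_mult norm_divide q_def[symmetric] power_divide)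
  also have "\<dots> = 4 * ((cmod w)\<^sup>2 + 1) / q\<^sup>2" using q by (simp add: power_mult_distrib power_divide field_simps)
  also have "(cmod w)\<^sup>2 + 1 = q" by (simp add: q_def)
  also have "4 * q / q\<^sup>2 = 4 / q" using q by (simp add: power2_eq_square)
  also have "\<dots> = (2 / sqrt q)\<^sup>2" using q by (simp add: power_divide)
  finally show ?thesis
    using q by (simp add: q_def)
qed

lemma dist_stereo_north_pole_less:
  assumes "r > 0" "cmod w > 2 / r"
  shows "dist (stereo w) north_pole < r"
proof -
  have "cmod w > 0" using assms by (meson divide_pos_pos less_trans zero_less_numeral)
  have "cmod w \<le> sqrt (1 + (cmod w)\<^sup>2)" by (rule real_le_rsqrt) simp
  moreover from this have "0 < sqrt (1 + (cmod w)\<^sup>2)" using \<open>cmod w > 0\<close> by linarith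
  ultimately have "2 / sqrt (1 + (cmod w)\<^sup>2) \<le> 2 / cmod w"
    using \<open>cmod w > 0\<close> by (intro divide_left_mono mult_pos_pos) auto
  also have "\<dots> < r" using assms \<open>cmod w > 0\<close> by (simp add: field_simps)
  finally show ?thesis by (simp add: dist_stereo_north_pole)
qed

lemma dist_stereo_north_pole_le: "dist (stereo w) north_pole \<le> 2"
proof -
  have "1 \<le> sqrt (1 + (cmod w)\<^sup>2)" by simp
  moreover from this have "0 < sqrt (1 + (cmod w)\<^sup>2)" by linarith
  ultimately have "2 / sqrt (1 + (cmod w)\<^sup>2) \<le> 2 / 1" by (intro divide_left_mono mult_pos_pos) auto
  thus ?thesis by (simp add: dist_stereo_north_pole)
qed

text \<open>The origin is antipodal to infinity, at chordal distance exactly 2.\<close>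

lemma zero_notin_punct_disc_inf: "r \<le> 2 \<Longrightarrow> 0 \<notin> punct_disc_inf r"
  by (simp add: punct_disc_inf_def dist_stereo_north_pole)

text \<open>As a map to the sphere \<open>f\<close> is continuous at poles too: near a pole its
  modulus exceeds \<open>2 / r\<close>.\<close>

lemma open_preimage_disc_inf:
  assumes f: "f nicely_meromorphic_on UNIV" and r: "r > 0"
  shows "open (preimage_disc_inf f r)"
proof (rule openI)
  fix a assume a: "a \<in> preimage_disc_inf f r"
  have "\<forall>\<^sub>F z in at a. z \<in> preimage_disc_inf f r"
  proof (cases "is_pole f a")
    case True
    hence "\<forall>M>0. \<forall>\<^sub>F z in at a. M \<le> cmod (f z)"
      unfolding is_pole_def filterlim_at_infinity[OF order_refl] .
    moreover have "2 / r + 1 > 0" using r by (simp add: add_pos_pos)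
    ultimately have "\<forall>\<^sub>F z in at a. 2 / r + 1 \<le> cmod (f z)" by blast
    thus ?thesis
    proof eventually_elim
      case (elim z)
      thus ?case using dist_stereo_north_pole_less[OF r, of "f z"] by (simp add: preimage_disc_inf_def)
    qed
  next
    case False
    hence "isCont f a"
      by (intro analytic_at_imp_isCont nicely_meromorphic_on_imp_analytic_at[OF f]) auto
    moreover have "isCont stereo (f a)"
      using continuous_on_stereo[of UNIV] by (simp add: continuous_on_eq_continuous_at)
    ultimately have "isCont (\<lambda>z. dist (stereo (f z)) north_pole) a"
      by (intro continuous_intros isCont_o2[of a f stereo])
    moreover have "dist (stereo (f a)) north_pole < r" using a False by (simp add: preimage_disc_inf_def)
    ultimately have "\<forall>\<^sub>F z in at a. dist (stereo (f z)) north_pole < r"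
      unfolding isCont_def by (rule order_tendstoD)
    thus ?thesis by eventually_elim (simp add: preimage_disc_inf_def)
  qed
  then obtain e where "e > 0" "\<And>z. z \<noteq> a \<Longrightarrow> dist z a < e \<Longrightarrow> z \<in> preimage_disc_inf f r"
    unfolding eventually_at by blast
  moreover have "ball a e \<subseteq> preimage_disc_inf f r"
  proof
    fix z assume "z \<in> ball a e"
    thus "z \<in> preimage_disc_inf f r"
      using a calculation(2)[of z] by (cases "z = a") (auto simp: dist_commute)
  qed
  ultimately show "\<exists>e>0. ball a e \<subseteq> preimage_disc_inf f r" by blast
qed

text \<open>The identity lifts to a section \<open>g\<close> whose range is open by invariance of
  domain and closed as the set where \<open>g (f z) = z\<close>. So \<open>f\<close> is a
  homeomorphism of the plane, in particular a proper entire map, hence a polynomial. This excludes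
  chordal radii above 2.\<close>

lemma plane_covering_imp_rational:
  assumes f: "f nicely_meromorphic_on UNIV" and cov: "covering_space UNIV f (UNIV :: complex set)"
  shows "\<not> transcendental_meromorphic f"
proof -
  have cont: "continuous_on UNIV f" by (rule covering_space_imp_continuous[OF cov])
  have "\<not> is_pole f z" for z
  proof
    assume "is_pole f z"
    moreover have "f \<midarrow>z\<rightarrow> f z" using cont by (simp add: continuous_on_eq_continuous_at isCont_def)
    ultimately show False using not_tendsto_and_filterlim_at_infinity[of "at z" f "f z"] by (simp add: is_pole_def)
  qed
  hence "f analytic_on {z}" for z using nicely_meromorphic_on_imp_analytic_at[OF f] by simp
  hence "f analytic_on UNIV" using analytic_on_analytic_at by blast
  hence hol: "f holomorphic_on UNIV" by (rule analytic_imp_holomorphic)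
  obtain g where g: "continuous_on UNIV g" "\<And>z. f (g z) = z"
    by (rule covering_space_lift[OF cov, of UNIV "\<lambda>z. z"])
       (auto intro!: convex_imp_simply_connected convex_imp_locally_path_connected)
  have "inj g" using g(2) by (metis injI)
  hence gopen: "open (range g)" using invariance_of_domain[OF g(1)] by simp
  have gclosed: "closed (range g)"
  proof -
    have "range g = {z. g (f z) = z}" using g(2) by (auto simp: image_iff) (metis)
    moreover have "closed {z. g (f z) = z}"
      using continuous_on_compose2[OF g(1) cont] by (intro closed_Collect_eq continuous_intros) auto
    ultimately show ?thesis by simp
  qed
  have "range g = UNIV" using gopen gclosed clopen[of "range g"] by blast
  hence gf: "g (f z) = z" for z using g(2) by (metis rangeE UNIV_I)
  have "compact {z. f z \<in> k}" if "compact k" for k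
  proof -
    have "{z. f z \<in> k} = g ` k" using gf g(2) by (auto simp: image_iff) (metis)
    thus ?thesis using compact_continuous_image[OF continuous_on_subset[OF g(1)] that] by simp
  qed
  then obtain c n where cn: "f = (\<lambda>z. \<Sum>i\<le>n. c i * z ^ i)"
    using proper_map_polyfun_eq[OF hol] by blast
  define p where "p = (\<Sum>i\<le>n. monom (c i) i)"
  have "\<forall>z. poly 1 z \<noteq> 0 \<longrightarrow> f z = poly p z / poly 1 z"
    by (simp add: p_def poly_sum poly_monom cn)
  thus ?thesis unfolding transcendental_meromorphic_def by (metis one_neq_zero)
qed

text \<open>\<open>\<psi>\<close> lifts \<open>exp\<close> through the covering \<open>f\<close>, and a branch of \<open>log f\<close> is a left
  inverse of \<open>\<psi>\<close> up to a constant, so \<open>\<psi>\<close> is injective. It can be zero in one point only.\<close>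
lemma logarithmic_coordinates:
  assumes f: "transcendental_meromorphic f" and sing: "log_singularity_over_inf f"
  obtains h0 G where "h0 \<ge> 0" "G holomorphic_on {z. h0 < Re z}"
    "\<And>x y. h0 < Re x \<Longrightarrow> h0 < Re y \<Longrightarrow> exp (G x) = exp (G y) \<Longrightarrow> x = y"
    "\<And>c. h0 < Re c \<Longrightarrow> filterlim (\<lambda>n. Re (G (shift c n))) at_top sequentially"
    "\<And>z. h0 < Re z \<Longrightarrow> \<not> is_pole f (exp (G z)) \<and> f (exp (G z)) = exp z"
proof -
  have nm: "f nicely_meromorphic_on UNIV" using f by (simp add: transcendental_meromorphic_def)
  obtain U r where r: "r > 0" and U: "U \<in> components (preimage_disc_inf f r)"
    and cov: "covering_space U f (punct_disc_inf r)" and sc: "simply_connected U"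
    using sing unfolding log_singularity_over_inf_def by blast
  have r2: "r \<le> 2"
  proof (rule ccontr)
    assume "\<not> r \<le> 2"
    hence "dist (stereo w) north_pole < r" for w using dist_stereo_north_pole_le[of w] by simp
    hence "preimage_disc_inf f r = UNIV" "punct_disc_inf r = UNIV"
      by (auto simp: preimage_disc_inf_def punct_disc_inf_def)
    moreover have "U = UNIV" using U calculation(1) by (simp add: components_def connected_component_UNIV) 
    ultimately show False using plane_covering_imp_rational[OF nm] cov f by simp
  qed
  have preopen: "open (preimage_disc_inf f r)" by (rule open_preimage_disc_inf[OF nm r])
  have Uopen: "open U" by (rule open_components[OF preopen U])
  have fU: "f z \<in> punct_disc_inf r" if "z \<in> U" for z
    using covering_space_imp_surjective[OF cov] that by blast
  have fnz: "f z \<noteq> 0" if "z \<in> U" for z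
    using fU[OF that] zero_notin_punct_disc_inf[OF r2] by metis
  \<comment> \<open>At a pole a nicely meromorphic function has the value 0, which the punctured
    disc excludes.\<close>
  have nopole: "\<not> is_pole f z" if z: "z \<in> U" for z
  proof
    assume p: "is_pole f z"
    have "f \<midarrow>z\<rightarrow> f z" using nm fnz[OF z] by (auto simp: nicely_meromorphic_on_def)
    thus False using p not_tendsto_and_filterlim_at_infinity[of "at z" f "f z"] by (simp add: is_pole_def)
  qed
  have "f analytic_on {z}" if "z \<in> U" for z
    using nicely_meromorphic_on_imp_analytic_at[OF nm] nopole[OF that] by simp
  hence "f analytic_on U" using analytic_on_analytic_at by blast
  hence fhol: "f holomorphic_on U" by (rule analytic_imp_holomorphic)
  obtain \<phi> where \<phi>: "\<phi> holomorphic_on U" "\<And>z. z \<in> U \<Longrightarrow> f z = exp (\<phi> z)"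
    using simply_connected_eq_holomorphic_log[OF Uopen] sc fhol fnz by metis
  define H where "H = {z. ln (2 / r) < Re z}"
  have Hopen: "open H" and Hconv: "convex H"
    unfolding H_def by (rule open_halfspace_Re_gt, rule convex_halfspace_Re_gt)
  have expH: "cmod (exp z) > 2 / r" if "z \<in> H" for z
  proof -
    have "exp (ln (2 / r)) < exp (Re z)" using that unfolding H_def by (subst exp_less_cancel_iff) simp
    thus ?thesis using r by simp
  qed
  have "exp \<in> H \<rightarrow> punct_disc_inf r"
    using dist_stereo_north_pole_less[OF r expH] by (auto simp: punct_disc_inf_def)
  moreover have "continuous_on H exp" by (intro continuous_intros)
  ultimately obtain \<psi> where \<psi>: "continuous_on H \<psi>" "\<psi> \<in> H \<rightarrow> U" "\<And>z. z \<in> H \<Longrightarrow> f (\<psi> z) = exp z"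
    using covering_space_lift[OF cov convex_imp_simply_connected[OF Hconv] convex_imp_locally_path_connected[OF Hconv]]
    by metis
  have \<psi>U: "\<psi> z \<in> U" if "z \<in> H" for z using \<psi>(2) that by blast
  have \<phi>cont: "continuous_on U \<phi>" by (rule holomorphic_on_imp_continuous_on[OF \<phi>(1)])
  \<comment> \<open>Both \<open>\<phi> (\<psi> z)\<close> and \<open>z\<close> are logarithms of
    \<open>f (\<psi> z)\<close>, so their continuous difference takes values in the discrete set of
    multiples of \<open>2 \<pi> i\<close>.\<close>
  have "(\<lambda>z. \<phi> (\<psi> z) - z) constant_on H"
  proof (rule continuous_discrete_range_constant)
    show "connected H" by (rule convex_connected[OF Hconv])
    show "continuous_on H (\<lambda>z. \<phi> (\<psi> z) - z)"
      using \<psi>U by (intro continuous_intros continuous_on_compose2[OF \<phi>cont \<psi>(1)]) auto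
    fix x assume x: "x \<in> H"
    show "\<exists>e>0. \<forall>y. y \<in> H \<and> \<phi> (\<psi> y) - y \<noteq> \<phi> (\<psi> x) - x \<longrightarrow> e \<le> cmod (\<phi> (\<psi> y) - y - (\<phi> (\<psi> x) - x))"
    proof (intro exI[of _ 1] conjI allI impI)
      fix y assume y: "y \<in> H \<and> \<phi> (\<psi> y) - y \<noteq> \<phi> (\<psi> x) - x"
      have e1: "exp (\<phi> (\<psi> z) - z) = 1" if "z \<in> H" for z
        using \<phi>(2)[OF \<psi>U[OF that]] \<psi>(3)[OF that] by (simp add: exp_diff)
      define d where "d = \<phi> (\<psi> y) - y - (\<phi> (\<psi> x) - x)"
      have "exp d = 1" unfolding d_def using e1[OF x] e1[of y] y by (subst exp_diff) simp
      then obtain n :: int where n: "Re d = 0" "Im d = of_int (2 * n) * pi" by (auto simp: exp_eq_1)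
      have "d \<noteq> 0" using y by (simp add: d_def)
      hence "n \<noteq> 0" using n by (auto simp: complex_eq_iff)
      hence "1 \<le> \<bar>real_of_int n\<bar>" by linarith
      hence "1 * 1 \<le> (2 * \<bar>real_of_int n\<bar>) * pi" using pi_gt3 by (intro mult_mono) auto
      also have "\<dots> = \<bar>Im d\<bar>" using n by (simp add: abs_mult)
      also have "\<dots> \<le> cmod d" by (rule abs_Im_le_cmod)
      finally show "1 \<le> cmod (\<phi> (\<psi> y) - y - (\<phi> (\<psi> x) - x))" by (simp add: d_def)
    qed simp
  qed
  then obtain c0 where c0': "\<And>z. z \<in> H \<Longrightarrow> \<phi> (\<psi> z) - z = c0" unfolding constant_on_def by blast
  have c0: "\<phi> (\<psi> z) = z + c0" if "z \<in> H" for z using c0'[OF that] by (simp add: algebra_simps)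
  have \<psi>inj: "inj_on \<psi> H"
  proof (rule inj_onI)
    fix x y assume xy: "x \<in> H" "y \<in> H" "\<psi> x = \<psi> y"
    have "x + c0 = y + c0"
      by (simp only: c0[OF xy(1), symmetric] c0[OF xy(2), symmetric] xy(3))
    thus "x = y" by simp
  qed
  \<comment> \<open>Lifting gives only continuity. By invariance of domain the image is open, and
    there the holomorphic inverse of the injective \<open>\<phi>\<close>, composed with the
    translation by \<open>c0\<close>, recovers \<open>\<psi>\<close>.\<close>
  have \<psi>hol: "\<psi> holomorphic_on H"
  proof -
    have S: "open (\<psi> ` H)" by (rule invariance_of_domain[OF \<psi>(1) Hopen \<psi>inj])
    have "\<phi> holomorphic_on \<psi> ` H" by (rule holomorphic_on_subset[OF \<phi>(1)]) (use \<psi>U in auto)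
    moreover have "inj_on \<phi> (\<psi> ` H)" by (rule inj_onI) (use c0 in auto)
    ultimately obtain g where g: "g holomorphic_on \<phi> ` \<psi> ` H" "\<And>z. z \<in> \<psi> ` H \<Longrightarrow> g (\<phi> z) = z"
      using holomorphic_has_inverse[OF _ S] by metis
    have "g \<circ> (\<lambda>z. z + c0) holomorphic_on H"
      by (rule holomorphic_on_compose_gen[OF _ g(1)]) (use c0 in \<open>auto intro!: holomorphic_intros simp: image_iff\<close>)
    moreover have "(g \<circ> (\<lambda>z. z + c0)) z = \<psi> z" if "z \<in> H" for z
      using g(2)[of "\<psi> z"] c0[OF that] that by simp
    ultimately show ?thesis by (rule holomorphic_transform)
  qed
  have "\<exists>x0. \<forall>z\<in>H. \<psi> z = 0 \<longrightarrow> Re z \<le> x0"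
  proof (cases "\<exists>z\<in>H. \<psi> z = 0")
    case True
    then obtain z0 where "z0 \<in> H" "\<psi> z0 = 0" by blast
    hence "\<forall>z\<in>H. \<psi> z = 0 \<longrightarrow> z = z0" using \<psi>inj by (auto simp: inj_on_def)
    thus ?thesis by (intro exI[of _ "Re z0"]) auto
  qed auto
  then obtain x0 where x0: "\<And>z. z \<in> H \<Longrightarrow> \<psi> z = 0 \<Longrightarrow> Re z \<le> x0" by blast
  \<comment> \<open>Beyond the only possible zero, \<open>\<psi>\<close> has a holomorphic
    logarithm.\<close>
  define h0 where "h0 = max 0 (max (ln (2 / r)) x0)"
  define Hq where "Hq = {z. h0 < Re z}"
  have HqH: "z \<in> H" if "z \<in> Hq" for z using that by (auto simp: Hq_def H_def h0_def)
  have \<psi>nz: "\<psi> z \<noteq> 0" if "z \<in> Hq" for z using x0[OF HqH[OF that]] that by (auto simp: Hq_def h0_def)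
  have "convex Hq" unfolding Hq_def by (rule convex_halfspace_Re_gt)
  hence Hqc: "contractible Hq" by (rule convex_imp_contractible)
  have \<psi>q: "\<psi> holomorphic_on Hq" by (rule holomorphic_on_subset[OF \<psi>hol]) (use HqH in auto)
  have "\<exists>G. G holomorphic_on Hq \<and> (\<forall>z\<in>Hq. \<psi> z = exp (G z))"
  proof (rule contractible_imp_holomorphic_log[OF \<psi>q Hqc])
    show "\<psi> z \<noteq> 0" if "z \<in> Hq" for z by (rule \<psi>nz[OF that])
    show ?thesis if "g holomorphic_on Hq" "\<And>z. z \<in> Hq \<Longrightarrow> \<psi> z = exp (g z)" for g
      using that by (intro exI[of _ g] conjI ballI)
  qed
  then obtain G where G: "G holomorphic_on Hq" "\<And>z. z \<in> Hq \<Longrightarrow> \<psi> z = exp (G z)" by blast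
  \<comment> \<open>A finite accumulation point \<open>a\<close> would be a pole or satisfy
    \<open>f a = exp c\<close>. Either way it lies in the open preimage of the disc, and hence in
    the component \<open>U\<close>. There \<open>\<phi>\<close> is continuous, yet
    \<open>\<phi> (\<psi> (shift c n)) = shift c n + c0\<close> has unbounded imaginary
    part.\<close>
  have escape: "finite {n. cmod (\<psi> (shift c n)) \<le> M}" if c: "c \<in> H" for c M
  proof (rule ccontr)
    have shH: "shift c n \<in> H" for n using c by (simp add: H_def shift_def)
    have expsh: "exp (shift c n) = exp c" for n
    proof -
      have "exp (of_real (2 * pi * real n) * \<i>) = 1"
        by (subst exp_eq_1) (auto intro!: exI[of _ "int n"])
      thus ?thesis by (simp add: shift_def exp_add)
    qed
    assume "infinite {n. cmod (\<psi> (shift c n)) \<le> M}"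
    then obtain s where s: "strict_mono (s :: nat \<Rightarrow> nat)" "\<And>n. cmod (\<psi> (shift c (s n))) \<le> M"
      using infinite_enumerate[of "{n. cmod (\<psi> (shift c n)) \<le> M}"] by auto
    have "bounded (range (\<lambda>n. \<psi> (shift c (s n))))" using s(2) by (auto intro: boundedI)
    then obtain a t where t: "strict_mono (t :: nat \<Rightarrow> nat)" "((\<lambda>n. \<psi> (shift c (s n))) \<circ> t) \<longlonglongrightarrow> a"
      using bounded_imp_convergent_subsequence by blast
    define u where "u = (\<lambda>n. s (t n))"
    have u: "strict_mono u" unfolding u_def using s(1) t(1) by (simp add: strict_mono_def)
    have lim: "(\<lambda>n. \<psi> (shift c (u n))) \<longlonglongrightarrow> a" using t(2) by (simp add: o_def u_def)
    have apre: "a \<in> preimage_disc_inf f r"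
    proof (cases "is_pole f a")
      case False
      hence "isCont f a"
        by (intro analytic_at_imp_isCont nicely_meromorphic_on_imp_analytic_at[OF nm]) auto
      hence "(\<lambda>n. f (\<psi> (shift c (u n)))) \<longlonglongrightarrow> f a" using lim by (rule isCont_tendsto_compose)
      hence "(\<lambda>n. exp c) \<longlonglongrightarrow> f a" using \<psi>(3)[OF shH] expsh by simp
      hence "f a = exp c" by (simp add: LIMSEQ_const_iff)
      thus ?thesis using dist_stereo_north_pole_less[OF r expH[OF c]] by (simp add: preimage_disc_inf_def)
    qed (simp add: preimage_disc_inf_def)
    obtain e where e: "e > 0" "ball a e \<subseteq> preimage_disc_inf f r"
      using preopen apre open_contains_ball by blast
    have "\<forall>\<^sub>F n in sequentially. dist (\<psi> (shift c (u n))) a < e" by (rule tendstoD[OF lim e(1)])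
    then obtain n where "dist (\<psi> (shift c (u n))) a < e" using eventually_happens by fastforce
    hence "\<psi> (shift c (u n)) \<in> U \<inter> ball a e" using \<psi>U[OF shH] by (simp add: dist_commute)
    hence "ball a e \<subseteq> U" using components_maximal[OF U _ e(2)] by (metis connected_ball empty_iff)
    hence aU: "a \<in> U" using e(1) by auto
    hence "isCont \<phi> a" using \<phi>cont Uopen by (simp add: continuous_on_eq_continuous_at)
    hence "(\<lambda>n. \<phi> (\<psi> (shift c (u n)))) \<longlonglongrightarrow> \<phi> a" using lim by (rule isCont_tendsto_compose)
    hence "(\<lambda>n. shift c (u n) + c0) \<longlonglongrightarrow> \<phi> a" using c0[OF shH] by simp
    hence "(\<lambda>n. Im (shift c (u n) + c0)) \<longlonglongrightarrow> Im (\<phi> a)" by (rule tendsto_Im)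
    hence "Bseq (\<lambda>n. Im (shift c (u n) + c0))" by (intro convergent_imp_Bseq convergentI)
    then obtain K where K: "\<And>n. \<bar>Im (shift c (u n) + c0)\<bar> \<le> K" unfolding Bseq_def by auto
    obtain N :: nat where N: "K + \<bar>Im c\<bar> + \<bar>Im c0\<bar> < real N" using reals_Archimedean2 by blast
    have "N \<le> u N" by (rule strict_mono_imp_increasing[OF u])
    hence "real N \<le> 1 * real (u N)" by simp
    also have "\<dots> \<le> (2 * pi) * real (u N)" using pi_gt3 by (intro mult_right_mono) auto
    finally have "real N \<le> 2 * pi * real (u N)" .
    thus False using K[of N] N by (simp add: shift_def)
  qed
  show thesis
  proof
    show "h0 \<ge> 0" by (simp add: h0_def)
    show "G holomorphic_on {z. h0 < Re z}" using G(1) by (simp add: Hq_def)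
    show "x = y" if "h0 < Re x" "h0 < Re y" "exp (G x) = exp (G y)" for x y
      using inj_onD[OF \<psi>inj, of x y] G(2) that HqH by (simp add: Hq_def)
    show "\<not> is_pole f (exp (G z)) \<and> f (exp (G z)) = exp z" if "h0 < Re z" for z
    proof -
      have z: "z \<in> Hq" using that by (simp add: Hq_def)
      show ?thesis using nopole[OF \<psi>U[OF HqH[OF z]]] \<psi>(3)[OF HqH[OF z]] G(2)[OF z] by simp
    qed
    show "filterlim (\<lambda>n. Re (G (shift c n))) at_top sequentially" if "h0 < Re c" for c
      unfolding filterlim_at_top
    proof
      fix Z :: real
      have sh: "shift c n \<in> Hq" for n using that by (simp add: Hq_def shift_def)
      have "c \<in> Hq" using that by (simp add: Hq_def)
      hence "finite {n. cmod (\<psi> (shift c n)) \<le> exp Z}" by (intro escape HqH)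
      hence "\<forall>\<^sub>F n in sequentially. n \<notin> {n. cmod (\<psi> (shift c n)) \<le> exp Z}"
        unfolding cofinite_eq_sequentially[symmetric] by (simp add: eventually_cofinite)
      thus "\<forall>\<^sub>F n in sequentially. Z \<le> Re (G (shift c n))"
      proof eventually_elim
        case (elim n)
        thus ?case using G(2)[OF sh[of n]] by simp
      qed
    qed
  qed
qed

theorem theorem1p5:
  fixes f :: "complex \<Rightarrow> complex"
  assumes "transcendental_meromorphic f"
    and "log_singularity_over_inf f"
  shows "hausdorff_dim (julia_set f) > 1"
proof -
  have nm: "f nicely_meromorphic_on UNIV" using assms(1) by (simp add: transcendental_meromorphic_def)
  show ?thesis
    by (rule logarithmic_coordinates[OF assms]) (rule hausdorff_dim_julia_gt_1[OF nm])
qed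

end
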